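(* Let $\alpha$ be a real number with $-3\le\alpha\le 0$ and let $f$ be an analytic function on the unit disk $\mathbb{D}$ that is not identically zero. Then the function $r\mapsto \log M_{2,\alpha}(f,r)$ is convex in $\log r$ for $r\in(0,1)$. Moreover, the range $-3\le\alpha\le 0$ is best possible: for every real $\alpha\notin[-3,0]$ there exists an analytic function $f$ on $\mathbb{D}$, not identically zero, such that $r\mapsto\log M_{2,\alpha}(f,r)$ is not convex in $\log r$ for $r\in(0,1)$.
   Context: $\mathbb{D}=\{z\in\mathbb{C}:|z|<1\}$, $r\mathbb{D}=\{z\in\mathbb{C}:|z|<r\}$, and $dA$ is area measure on $\mathbb{D}$. For real $\alpha$, $dA_\alpha(z)=(1-|z|^2)^\alpha\,dA(z)$. For $f$ analytic on $\mathbb{D}$ and $0<p<\infty$, $$M_{p,\alpha}(f,r)=\frac{\int_{r\mathbb{D}}|f(z)|^p\,dA_\alpha(z)}{\int_{r\mathbb{D}}dA_\alpha(z)},\qquad 0<r<1.$$ A function $g$ on $(0,1)$ is said to be convex in $\log r$ if $t\mapsto g(e^t)$ is a convex function on $(-\infty,0)$. *)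

theory Defs
  imports "HOL-Analysis.Analysis"
begin

definition weighted_area :: "real \<Rightarrow> complex measure" where
  "weighted_area \<alpha> =
     density lborel (\<lambda>z. indicator (ball 0 1) z * ennreal ((1 - (norm z)\<^sup>2) powr \<alpha>))"

text \<open>The normalisation of area measure is immaterial here, as it cancels in the quotient.\<close>

definition integral_mean :: "real \<Rightarrow> real \<Rightarrow> (complex \<Rightarrow> complex) \<Rightarrow> real \<Rightarrow> real" where
  "integral_mean p \<alpha> f r =
     (LINT z:ball 0 r|weighted_area \<alpha>. norm (f z) powr p) / (LINT z:ball 0 r|weighted_area \<alpha>. 1)"

text \<open>Only the values of \<open>g\<close> on the interval from 0 to 1 (both excluded) matter.\<close>

definition convex_in_log :: "(real \<Rightarrow> real) \<Rightarrow> bool" where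
  "convex_in_log g \<longleftrightarrow> convex_on {..<0} (\<lambda>t. g (exp t))"

end

theory Submission
  imports Defs "HOL-Complex_Analysis.Complex_Analysis" "HOL-Real_Asymp.Real_Asymp"
begin

text \<open>
  Put \<open>a = -\<alpha>\<close>, \<open>x = r\<^sup>2\<close> and let \<open>F\<^sub>k(x)\<close> be the integral of \<open>s\<^sup>k (1 - s) powr (-a)\<close> over \<open>[0, x]\<close>.
  By orthogonality of the monomials on discs, the mean of \<open>f = \<Sum> b\<^sub>k z\<^sup>k\<close> is \<open>\<Sum> |b\<^sub>k|\<^sup>2 F\<^sub>k(x) / F\<^sub>0(x)\<close>;
  since sums of log-convex functions are log-convex, it suffices to treat \<open>F\<^sub>k / F\<^sub>0\<close>.

  With \<open>D = x d/dx\<close> let \<open>G = D log F\<^sub>0\<close>, \<open>E = D log G\<close>, \<open>\<rho> = F\<^sub>k / (x\<^sup>k F\<^sub>0)\<close>. Then \<open>D\<^sup>2 log (F\<^sub>k / F\<^sub>0) = G Q / \<rho>\<^sup>2\<close>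
  with \<open>Q = E \<rho> (1 - \<rho>) - D\<rho>\<close>, and
  \<open>D Q = \<rho> (1 - \<rho>) (D E - \<rho> E\<^sup>2) - Q (G + k - E \<rho>)\<close>. As \<open>Q\<close> vanishes at \<open>0\<close>, it is enough that
  \<open>D Q \<ge> 0\<close> wherever \<open>Q < 0\<close>. There \<open>E \<rho> < G\<close>, so the point is that \<open>Q < 0\<close> implies \<open>\<rho> E\<^sup>2 \<le> D E\<close>; the case \<open>k = 1\<close>
  is the worst one, and it becomes an inequality in \<open>E\<close> and \<open>x\<close> alone. It follows from lower bounds for \<open>G\<close>
  that are instances of the weighted AM-GM inequality.

  Outside the range, \<open>f(z) = z\<close> is a counterexample: for \<open>\<alpha> > 0\<close> its mean drops below its asymptote \<open>x / 2\<close> at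
  \<open>0\<close>, and for \<open>\<alpha> < -3\<close> it drops below its tangent power \<open>x powr L\<close> at \<open>1\<close>.
\<close>

subsection \<open>Moments of the radial weight\<close>

definition weight_moment :: "real \<Rightarrow> nat \<Rightarrow> real \<Rightarrow> real" where
  "weight_moment a k x = integral {0..x} (\<lambda>s. s ^ k * (1 - s) powr (-a))"

lemma weight_moment_integrable:
  assumes "x < 1" shows "(\<lambda>s::real. s ^ k * (1 - s) powr (-a)) integrable_on {u..x}"
  using assms by (intro integrable_continuous_real continuous_intros) auto

lemma weight_moment_has_derivative:
  assumes x: "0 < x" "x < 1"
  shows "(weight_moment a k has_real_derivative x ^ k * (1 - x) powr (-a)) (at x)"
proof -
  \<comment> \<open>With \<open>u\<close> strictly between \<open>x\<close> and 1, the integrand is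
    continuous on \<open>{0..u}\<close> and \<open>x\<close> is an interior point, so the derivative
    within the interval is the full one.\<close>
  define u where "u = (x + 1) / 2"
  have u: "x < u" "u < 1" using x by (auto simp: u_def)
  have "(weight_moment a k has_real_derivative x ^ k * (1 - x) powr (-a)) (at x within {0..u})"
    unfolding weight_moment_def using x u
    by (intro integral_has_real_derivative) (auto intro!: continuous_intros)
  moreover have "at x within {0..u} = at x"
    using x u by (intro at_within_interior) auto
  ultimately show ?thesis by simp
qed

lemma integral_power_Icc:
  fixes x :: real
  assumes "0 \<le> x"
  shows "integral {0..x} (\<lambda>s. s ^ k) = x ^ Suc k / real (Suc k)" and "(\<lambda>s. s ^ k) integrable_on {0..x}"
proof -
  have "((\<lambda>s. s ^ k) has_integral (x ^ Suc k / real (Suc k) - 0 ^ Suc k / real (Suc k))) {0..x}"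
    using assms
    by (intro fundamental_theorem_of_calculus)
       (auto simp: has_real_derivative_iff_has_vector_derivative[symmetric] simp del: power_Suc
          intro!: derivative_eq_intros)
  then show "integral {0..x} (\<lambda>s. s ^ k) = x ^ Suc k / real (Suc k)" "(\<lambda>s. s ^ k) integrable_on {0..x}"
    by (auto simp: integral_unique has_integral_integrable)
qed

text \<open>For \<open>a \<ge> 0\<close> the weight is nondecreasing, so on \<open>{0..x}\<close> it
  lies between 1 and its value at \<open>x\<close>. These bounds give all the limits at 0.\<close>

lemma weight_moment_bounds:
  assumes x: "0 \<le> x" "x < 1" and a: "0 \<le> a"
  shows "x ^ Suc k / real (Suc k) \<le> weight_moment a k x"
    and "weight_moment a k x \<le> x ^ Suc k / real (Suc k) * (1 - x) powr (-a)"
proof -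
  note int = integral_power_Icc[OF x(1), of k]
  have "integral {0..x} (\<lambda>s. s ^ k) \<le> weight_moment a k x"
    unfolding weight_moment_def
  proof (intro integral_le int weight_moment_integrable x)
    fix s assume s: "s \<in> {0..x}"
    have "s ^ k * 1 \<le> s ^ k * (1 - s) powr (-a)"
      using s x a powr_mono2'[of "-a" "1 - s" 1] by (intro mult_left_mono) auto
    then show "s ^ k \<le> s ^ k * (1 - s) powr (-a)" by simp
  qed
  then show "x ^ Suc k / real (Suc k) \<le> weight_moment a k x" by (simp only: int)
  have "weight_moment a k x \<le> integral {0..x} (\<lambda>s. s ^ k * (1 - x) powr (-a))"
    unfolding weight_moment_def
  proof (intro integral_le weight_moment_integrable x integrable_on_mult_left int)
    fix s assume s: "s \<in> {0..x}"
    show "s ^ k * (1 - s) powr (-a) \<le> s ^ k * (1 - x) powr (-a)"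
      using s x a powr_mono2'[of "-a" "1 - x" "1 - s"] by (intro mult_left_mono) auto
  qed
  also have "\<dots> = x ^ Suc k / real (Suc k) * (1 - x) powr (-a)"
    by (simp only: integral_mult_left int)
  finally show "weight_moment a k x \<le> x ^ Suc k / real (Suc k) * (1 - x) powr (-a)" .
qed

text \<open>The weight is monotone, hence at least the smaller of its endpoint values. Both signs of
  \<open>a\<close> occur, since the counterexample for \<open>\<alpha> > 0\<close> has
  \<open>a < 0\<close>.\<close>

lemma weight_moment_pos:
  assumes "0 < x" "x < 1"
  shows "0 < weight_moment a k x"
proof -
  have "0 < min 1 ((1 - x) powr (-a)) * (x ^ Suc k / real (Suc k))" using assms by simp
  also have "\<dots> = integral {0..x} (\<lambda>s. min 1 ((1 - x) powr (-a)) * s ^ k)"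
    using integral_power_Icc(1)[of x k] assms by simp
  also have "\<dots> \<le> weight_moment a k x"
    unfolding weight_moment_def
  proof (intro integral_le weight_moment_integrable assms integrable_on_mult_right integral_power_Icc)
    fix s assume s: "s \<in> {0..x}"
    have "min 1 ((1 - x) powr (-a)) \<le> (1 - s) powr (-a)"
    proof (cases "0 \<le> a")
      case True
      then show ?thesis using s assms powr_mono2'[of "-a" "1 - s" 1] by auto
    next
      case False
      then show ?thesis using s assms powr_mono2[of "-a" "1 - x" "1 - s"] by auto
    qed
    then show "min 1 ((1 - x) powr (-a)) * s ^ k \<le> s ^ k * (1 - s) powr (-a)"
      using s mult_right_mono[of "min 1 ((1 - x) powr (-a))" "(1 - s) powr (-a)" "s ^ k"]
      by (simp add: mult.commute)
  qed (use assms in auto)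
  finally show ?thesis .
qed

lemma integral_powr_one_minus:
  fixes c x :: real
  assumes "0 \<le> x" "x < 1" "c \<noteq> -1"
  shows "integral {0..x} (\<lambda>s. (1 - s) powr c) = (1 - (1 - x) powr (c + 1)) / (c + 1)"
proof -
  have "((\<lambda>s. (1 - s) powr c) has_integral
      (- ((1 - x) powr (c + 1)) / (c + 1) - (- ((1 - 0) powr (c + 1)) / (c + 1)))) {0..x}"
  proof (rule fundamental_theorem_of_calculus)
    fix s assume s: "s \<in> {0..x}"
    have "c + 1 \<noteq> 0" using assms by linarith
    then have "((\<lambda>s. - ((1 - s) powr (c + 1)) / (c + 1)) has_real_derivative (1 - s) powr c)
        (at s within {0..x})"
      using s assms by (auto intro!: derivative_eq_intros)
    then show "((\<lambda>s. - ((1 - s) powr (c + 1)) / (c + 1)) has_vector_derivative (1 - s) powr c)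
        (at s within {0..x})"
      by (simp add: has_real_derivative_iff_has_vector_derivative)
  qed (use assms in auto)
  then show ?thesis by (simp add: integral_unique diff_divide_distrib)
qed

lemma weight_moment_0_eq:
  assumes "0 \<le> x" "x < 1" "a \<noteq> 1"
  shows "weight_moment a 0 x = ((1 - x) powr (1 - a) - 1) / (a - 1)"
  using integral_powr_one_minus[of x "-a"] assms
  by (simp add: weight_moment_def add.commute) (simp add: divide_simps, simp add: algebra_simps)

subsection \<open>The growth inequality\<close>

text \<open>Weighted AM-GM for \<open>y\<close> and 1: the concave power lies below its tangent at
  1.\<close>

lemma powr_le_affine:
  fixes y \<theta> :: real
  assumes "0 < y" "0 \<le> \<theta>" "\<theta> \<le> 1"
  shows "y powr \<theta> \<le> (1 - \<theta>) + \<theta> * y"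
  using Youngs_inequality_0[of \<theta> "1 - \<theta>" y 1] assms by simp

text \<open>
  The growth inequality below in the variables \<open>y = 1 - x\<close>, \<open>v = y E\<close>, \<open>z = y\<^sup>2 (E\<^sup>2 - D E)\<close>. Its hypotheses force \<open>y \<le> 1/2\<close>.
\<close>

lemma barrier_polynomial_nonneg:
  fixes a v y z :: real
  assumes y: "0 < y" "y < 1" and a: "2 \<le> a" "a \<le> 3"
    and z_def: "z = (y + a * (1 - y)) * v - a * (1 - y)" and z: "0 \<le> z"
    and v: "v \<le> 1 - 2 * y\<^sup>2 / (1 + y)"
  shows "0 \<le> z * (2 * v\<^sup>2 - a * (1 - y) - 2 * z) + y * v * (v\<^sup>2 - z)"
proof -
  define t where "t = 1 - v"
  define r where "r = z / y"
  have zr: "z = y * r" using y by (simp add: r_def)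
  have r0: "0 \<le> r" using z y by (simp add: r_def)
  have t_lb: "2 * y\<^sup>2 \<le> t * (1 + y)"
    using v y by (simp add: t_def field_simps)
  have t0: "0 \<le> t" using t_lb y by (smt (verit) mult_nonneg_nonpos2 zero_le_power2 mult_neg_pos zero_less_power)
  have yr: "y * r = y * (1 - t) - a * (1 - y) * t"
    using z_def zr by (simp add: t_def algebra_simps)
  \<comment> \<open>The formula for \<open>y * r\<close> is decreasing in \<open>a\<close>, so
    \<open>a = 2\<close> gives an upper bound.\<close>
  have "2 * ((1 - y) * t) \<le> a * ((1 - y) * t)"
    using a t0 y by (intro mult_right_mono) auto
  then have yr_le: "y * r \<le> y - (2 - y) * t"
    using yr by (simp add: algebra_simps)
  have t_ub: "(2 - y) * t \<le> y"
    using yr_le r0 y by (smt (verit) mult_nonneg_nonneg)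
  \<comment> \<open>The lower and upper bounds on \<open>t\<close> are compatible only if
    \<open>(1 - y) * (1 - 2 * y)\<close> is nonnegative.\<close>
  have "2 * y\<^sup>2 * (2 - y) \<le> t * (1 + y) * (2 - y)"
    using t_lb y by (intro mult_right_mono) auto
  also have "\<dots> \<le> y * (1 + y)"
    using mult_right_mono[OF t_ub, of "1 + y"] y by (simp add: algebra_simps)
  finally have "y * ((1 - y) * (1 - 2 * y)) \<ge> 0"
    by (simp add: algebra_simps power2_eq_square)
  then have y_half: "y \<le> 1 / 2"
    using y by (simp add: zero_le_mult_iff)
  have t1: "t \<le> 1 / 3"
  proof -
    have "3 / 2 * t \<le> (2 - y) * t" using t0 y_half by (intro mult_right_mono) auto
    then show ?thesis using t_ub y_half by linarith
  qed
  \<comment> \<open>\<open>- s\<close> is the value of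
    \<open>2 * v\<^sup>2 - a * (1 - y) - y * v - 2 * z\<close> after replacing \<open>a\<close> by 3
    and \<open>z\<close> by its upper bound \<open>y - (2 - y) * t\<close>.\<close>
  define s where "s = 1 + y * t - 2 * t\<^sup>2"
  have s0: "0 \<le> s"
  proof -
    have "t\<^sup>2 \<le> (1/3)\<^sup>2" using t0 t1 by (intro power_mono) auto
    then have "2 * t\<^sup>2 \<le> 1" by (simp add: power2_eq_square)
    then show ?thesis using y t0 by (simp add: s_def add_increasing2)
  qed
  have v_eq: "v = 1 - t" by (simp add: t_def)
  have main: "0 \<le> v ^ 3 - r * s"
  proof -
    have "y * r * s \<le> (y - (2 - y) * t) * s"
      using yr_le s0 by (intro mult_right_mono) auto
    \<comment> \<open>The terms free of \<open>t\<close> cancel, so a factor \<open>t\<close> splits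
      off and only the bracket needs a sign.\<close>
    moreover have "y * v ^ 3 - (y - (2 - y) * t) * s
        = t * ((2 - 4 * y - y\<^sup>2) + t * (7 * y - y\<^sup>2) - t\<^sup>2 * (4 - y))"
      unfolding v_eq s_def by (simp add: algebra_simps power2_eq_square power3_eq_cube)
    moreover have "0 \<le> (2 - 4 * y - y\<^sup>2) + t * (7 * y - y\<^sup>2) - t\<^sup>2 * (4 - y)"
    proof -
      \<comment> \<open>Of the term \<open>7 y t\<close>, the portion \<open>7/3 y t\<close> pays
        for \<open>t^2 (4 - y)\<close>. The rest, together with \<open>t \<ge> 4/3 y^2\<close>,
        yields \<open>16/3 y^3\<close>, and a polynomial in \<open>y\<close> alone remains.\<close>
      have "t * ((4 - y) * t) \<le> t * (7 / 3 * y)"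
      proof (rule mult_left_mono)
        have "(4 - y) * t \<le> 7 / 3 * (2 - y) * t" using y_half t0 by (intro mult_right_mono) auto
        then show "(4 - y) * t \<le> 7 / 3 * y" using t_ub by linarith
      qed (fact t0)
      moreover have "4 / 3 * y\<^sup>2 \<le> t"
      proof -
        have "t * (1 + y) \<le> t * (3 / 2)" using t0 y_half by (intro mult_left_mono) auto
        then show ?thesis using t_lb by linarith
      qed
      then have "4 / 3 * y\<^sup>2 * (4 * y) \<le> t * (14 / 3 * y - y\<^sup>2)"
      proof (rule mult_mono)
        show "4 * y \<le> 14 / 3 * y - y\<^sup>2"
          using mult_left_mono[OF y_half, of y] y unfolding power2_eq_square by linarith
      qed (use y t0 in auto)
      moreover have "0 \<le> 2 - 4 * y - y\<^sup>2 + 16 / 3 * (y\<^sup>2 * y)"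
      proof -
        have "y\<^sup>2 * (1 / 2 - y) \<le> 1 / 4 * (1 / 2 - y)"
          using power_mono[OF y_half, of 2] y y_half
          by (intro mult_right_mono) (auto simp: power2_eq_square)
        moreover have "0 \<le> y\<^sup>2" by simp
        ultimately show ?thesis using y_half unfolding right_diff_distrib by linarith
      qed
      ultimately show ?thesis
        by (simp add: algebra_simps power2_eq_square)
    qed
    ultimately have "0 \<le> y * (v ^ 3 - r * s)"
      using t0 by (smt (verit, ccfv_SIG) mult_nonneg_nonneg right_diff_distrib mult.assoc)
    then show ?thesis using y by (simp add: zero_le_mult_iff)
  qed
  have "2 * v\<^sup>2 - a * (1 - y) - y * v - 2 * z \<ge> - s"
  proof -
    have "a * (1 - y) \<le> 3 * (1 - y)"
      using a y by (intro mult_right_mono) auto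
    then show ?thesis
      using yr_le unfolding zr v_eq s_def by (simp add: algebra_simps power2_eq_square)
  qed
  then have "r * (2 * v\<^sup>2 - a * (1 - y) - y * v - 2 * z) \<ge> r * (- s)"
    using r0 by (intro mult_left_mono) auto
  then have "0 \<le> y * (v ^ 3 + r * (2 * v\<^sup>2 - a * (1 - y) - y * v - 2 * z))"
    using main y by (intro mult_nonneg_nonneg) auto
  also have "\<dots> = z * (2 * v\<^sup>2 - a * (1 - y) - 2 * z) + y * v * (v\<^sup>2 - z)"
    unfolding zr by (simp add: algebra_simps power2_eq_square power3_eq_cube)
  finally show ?thesis .
qed

text \<open>The iterated derivatives of the mass \<open>F\<^sub>0\<close> along \<open>D = x d/dx\<close>: \<open>G = D log F\<^sub>0\<close>, \<open>E = D log G\<close>, \<open>D E\<close>.\<close>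

definition mass_log_deriv :: "real \<Rightarrow> real \<Rightarrow> real" where
  "mass_log_deriv a x = x * (1 - x) powr (-a) / weight_moment a 0 x"

definition mass_log_deriv2 :: "real \<Rightarrow> real \<Rightarrow> real" where
  "mass_log_deriv2 a x = 1 + a * x / (1 - x) - mass_log_deriv a x"

definition mass_log_deriv3 :: "real \<Rightarrow> real \<Rightarrow> real" where
  "mass_log_deriv3 a x = a * x / (1 - x)\<^sup>2 - mass_log_deriv a x * mass_log_deriv2 a x"

lemma mass_log_deriv_ge_1:
  assumes "0 \<le> a" "0 < x" "x < 1"
  shows "1 \<le> mass_log_deriv a x"
  using weight_moment_bounds(2)[of x a 0] weight_moment_pos[of x a 0] assms by (simp add: mass_log_deriv_def)

text \<open>For \<open>a > 1\<close> this turns lower bounds for \<open>G\<close> into lower bounds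
  for the single power \<open>p = (1 - x) powr (a - 1)\<close>.\<close>

lemma mass_log_deriv_eq:
  assumes x: "0 < x" "x < 1" and a: "a \<noteq> 1"
  shows "(1 - x) * mass_log_deriv a x = (a - 1) * x / (1 - (1 - x) powr (a - 1))"
proof -
  define p where "p = (1 - x) powr (a - 1)"
  have p: "0 < p" "p \<noteq> 1" using x a by (auto simp: p_def)
  have "(1 - x) powr (1 - a) = 1 / p"
    using powr_minus_divide[of "1 - x" "a - 1"] by (simp add: p_def)
  then have F: "weight_moment a 0 x = (1 / p - 1) / (a - 1)" and w: "(1 - x) * (1 - x) powr (-a) = 1 / p"
    using x a powr_add[of "1 - x" 1 "-a"] by (simp_all add: weight_moment_0_eq)
  have "(1 - x) * mass_log_deriv a x = x * ((1 - x) * (1 - x) powr (-a)) / weight_moment a 0 x"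
    by (simp add: mass_log_deriv_def)
  also have "\<dots> = x * (1 / p) / ((1 / p - 1) / (a - 1))" by (simp only: F w)
  also have "\<dots> = (a - 1) * x / (1 - p)"
    using p a by (simp add: divide_simps)
  finally show ?thesis by (simp add: p_def)
qed

text \<open>Write \<open>y = 1 - x\<close> as \<open>p * y powr (2 - a)\<close> and bound the second
  factor by AM-GM; this bounds \<open>p\<close> from below. Equality holds at
  \<open>a = 2\<close>.\<close>

lemma mass_log_deriv_ge_of_le_2:
  assumes x: "0 < x" "x < 1" and a: "1 < a" "a \<le> 2"
  shows "1 + (a - 2) * x \<le> (1 - x) * mass_log_deriv a x"
proof -
  define y where "y = 1 - x"
  define p where "p = y powr (a - 1)"
  have y: "0 < y" "y < 1" using x by (auto simp: y_def)
  have p: "0 < p" "p < 1" using y a powr_less_mono2[of "a - 1" y 1] by (auto simp: p_def)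
  have "y = p * y powr (2 - a)" using y by (simp add: p_def flip: powr_add)
  also have "\<dots> \<le> p * ((1 - (2 - a)) + (2 - a) * y)"
    using y a p by (intro mult_left_mono powr_le_affine) auto
  finally have "(1 + (a - 2) * x) * (1 - p) \<le> (a - 1) * x"
    by (simp add: y_def algebra_simps)
  then show ?thesis
    using p mass_log_deriv_eq[OF x, of a] a by (simp add: pos_le_divide_eq p_def y_def)
qed

text \<open>The same device applied to \<open>y^2\<close> with exponent \<open>(3 - a) / 2\<close>,
  chosen so that the bound is exact at \<open>a = 3\<close>.\<close>

lemma mass_log_deriv_ge_of_le_3:
  assumes x: "0 < x" "x < 1" and a: "2 \<le> a" "a \<le> 3"
  shows "(a - 1) * x + 2 * (1 - x)\<^sup>2 / (2 - x) \<le> (1 - x) * mass_log_deriv a x"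
proof -
  define y where "y = 1 - x"
  define p where "p = y powr (a - 1)"
  have y: "0 < y" "y < 1" using x by (auto simp: y_def)
  have p: "0 < p" "p < 1" using y a powr_less_mono2[of "a - 1" y 1] by (auto simp: p_def)
  have "y\<^sup>2 = p * y powr (3 - a)" using y by (simp add: p_def flip: powr_add)
  also have "y powr (3 - a) = (y\<^sup>2) powr ((3 - a) / 2)"
    using y powr_powr[of y 2 "(3 - a) / 2"] by (simp add: diff_divide_distrib)
  also have "p * \<dots> \<le> p * ((1 - (3 - a) / 2) + (3 - a) / 2 * y\<^sup>2)"
    using y a p by (intro mult_left_mono powr_le_affine) auto
  finally have "((a - 1) * x * (1 + y) + 2 * y\<^sup>2) * (1 - p) \<le> (a - 1) * x * (1 + y)"
    by (simp add: y_def field_simps power2_eq_square)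
  then have "(a - 1) * x * (1 + y) + 2 * y\<^sup>2 \<le> (a - 1) * x * (1 + y) / (1 - p)"
    using p by (simp add: pos_le_divide_eq)
  also have "\<dots> = (1 - x) * mass_log_deriv a x * (1 + y)"
    using mass_log_deriv_eq[OF x, of a] a by (simp add: p_def y_def)
  finally have "((a - 1) * x * (1 + y) + 2 * y\<^sup>2) / (1 + y) \<le> (1 - x) * mass_log_deriv a x"
    using y by (simp add: pos_divide_le_eq)
  moreover have "((a - 1) * x * (1 + y) + 2 * y\<^sup>2) / (1 + y) = (a - 1) * x + 2 * y\<^sup>2 / (1 + y)"
    using y by (simp add: add_divide_distrib)
  moreover have "1 + y = 2 - x" by (simp add: y_def)
  ultimately show ?thesis by (simp add: y_def)
qed

text \<open>
  With \<open>c = D / E\<^sup>2\<close>, the second alternative says that the convexity defect for \<open>k = 1\<close> would be nonnegative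
  if the moment ratio were \<open>c\<close>.
\<close>

lemma mass_log_deriv2_growth:
  assumes a: "0 \<le> a" "a \<le> 3" and x: "0 < x" "x < 1"
  defines "G \<equiv> mass_log_deriv a x" and "E \<equiv> mass_log_deriv2 a x" and "D \<equiv> mass_log_deriv3 a x"
  shows "E\<^sup>2 \<le> D \<or> (0 < E \<and> 0 \<le> (E\<^sup>2 - D) * (D - G * E) + E * D)"
proof -
  define y where "y = 1 - x"
  have y: "0 < y" "y < 1" and x_eq: "x = 1 - y" using x by (auto simp: y_def)
  define v where "v = y * E"
  define z where "z = (y + a * (1 - y)) * v - a * (1 - y)"
  have E: "E = v / y" using y by (simp add: v_def)
  have G: "G = (y + a * x - v) / y"
    unfolding v_def E_def mass_log_deriv2_def G_def using y by (simp add: y_def divide_simps)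
  have yG: "y * G = y + a * x - v" and yE: "y * E = v" using y by (simp_all add: G E)
  have "D = a * x / (1 - x)\<^sup>2 - G * E"
    by (simp add: D_def mass_log_deriv3_def G_def E_def)
  then have "y\<^sup>2 * D = a * x - (y * G) * (y * E)"
    using y by (simp add: y_def[symmetric] power2_eq_square right_diff_distrib)
  also have "\<dots> = v\<^sup>2 - z"
    unfolding yG yE by (simp add: z_def x_eq algebra_simps power2_eq_square)
  finally have D: "D = (v\<^sup>2 - z) / y\<^sup>2"
    using y by (simp add: eq_divide_eq mult.commute)
  show ?thesis
  \<comment> \<open>Since \<open>D = (v\<^sup>2 - z) / y\<^sup>2\<close>, the case
    \<open>z \<le> 0\<close> is the first alternative.\<close>
  proof (cases "z \<le> 0")
    case True
    then show ?thesis using y unfolding D E by (simp add: power_divide divide_right_mono)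
  next
    case False
    then have "0 < (y + a * x) * v" using a x by (smt (verit) z_def x_eq mult_nonneg_nonneg)
    then have v0: "0 < v" using y x a by (simp add: zero_less_mult_iff) (smt (verit) mult_nonneg_nonneg)
    \<comment> \<open>For \<open>a < 2\<close> the lower bounds on \<open>G\<close> keep
      \<open>v\<close> below \<open>a * x\<close> or \<open>x\<close>, which makes
      \<open>z \<le> 0\<close>. The second alternative is thus at stake only for
      \<open>a \<ge> 2\<close>.\<close>
    have a2: "2 \<le> a"
    proof (rule ccontr)
      assume n: "\<not> 2 \<le> a"
      show False
      proof (cases "a \<le> 1")
        case True
        have "y * 1 \<le> y * G" using mass_log_deriv_ge_1 a x y unfolding G_def by (intro mult_left_mono) auto
        then have "v \<le> a * x" using yG by simp
        then have "(y + a * x) * v \<le> (y + a * x) * (a * x)"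
          using y a x by (intro mult_left_mono) auto
        also have "\<dots> = a * x + a * x * (x * (a - 1))" by (simp add: x_eq algebra_simps)
        also have "\<dots> \<le> a * x"
          using True a x by (simp add: mult_nonneg_nonpos)
        finally show False using False by (simp add: z_def x_eq)
      next
        case a1: False
        have "v \<le> x" using mass_log_deriv_ge_of_le_2[OF x, of a] a1 n yG
          by (simp add: G_def y_def algebra_simps)
        then have "(y + a * x) * v \<le> (y + a * x) * x"
          using y a x by (intro mult_left_mono) auto
        also have "\<dots> = a * x + x * (y * (1 - a))" by (simp add: x_eq algebra_simps)
        also have "\<dots> \<le> a * x"
          using a1 y x by (simp add: mult_nonneg_nonpos)
        finally show False using False by (simp add: z_def x_eq)
      qed
    qed
    have "v \<le> 1 - 2 * y\<^sup>2 / (1 + y)"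
      using mass_log_deriv_ge_of_le_3[OF x a2 a(2)] yG by (simp add: G_def y_def algebra_simps)
    then have "0 \<le> z * (2 * v\<^sup>2 - a * (1 - y) - 2 * z) + y * v * (v\<^sup>2 - z)"
      using barrier_polynomial_nonneg[OF y a2 a(2) z_def] False by simp
    also have "\<dots> = y ^ 4 * ((E\<^sup>2 - D) * (D - G * E) + E * D)"
    proof -
      have e1: "E\<^sup>2 - D = z / y\<^sup>2" unfolding E D using y by (simp add: power_divide diff_divide_distrib)
      have e2: "D - G * E = (2 * v\<^sup>2 - a * (1 - y) - 2 * z) / y\<^sup>2"
        unfolding E D G z_def x_eq using y by (simp add: divide_simps) (simp add: algebra_simps power2_eq_square)
      have e3: "E * D = v * (v\<^sup>2 - z) / y ^ 3"
        unfolding E D using y by (simp add: power2_eq_square power3_eq_cube)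
      have "y ^ 4 * (A / y\<^sup>2 * (B / y\<^sup>2) + C / y ^ 3) = A * B + y * C" for A B C
      proof -
        have "y ^ 4 * (A / y\<^sup>2 * (B / y\<^sup>2)) = (y\<^sup>2 * (A / y\<^sup>2)) * (y\<^sup>2 * (B / y\<^sup>2))"
          by (simp add: power2_eq_square power4_eq_xxxx)
        moreover have "y ^ 4 * (C / y ^ 3) = y * (y ^ 3 * (C / y ^ 3))"
          by (simp add: power3_eq_cube power4_eq_xxxx)
        ultimately show ?thesis using y by (simp add: distrib_left)
      qed
      then show ?thesis unfolding e1 e2 e3 by (simp add: mult.assoc)
    qed
    finally show ?thesis using y v0 by (simp add: E zero_le_mult_iff)
  qed
qed

subsection \<open>Logarithmic convexity for monomials\<close>

text \<open>Wherever \<open>f\<close> is negative it is nondecreasing to the right. Hence to the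
  left of a negative value \<open>f\<close> stays at or below that value and cannot tend to
  0.\<close>

lemma nonneg_of_deriv_nonneg_when_neg:
  fixes f f' :: "real \<Rightarrow> real"
  assumes deriv: "\<And>x. 0 < x \<Longrightarrow> x < b \<Longrightarrow> (f has_real_derivative f' x) (at x)"
    and lim: "(f \<longlongrightarrow> 0) (at_right 0)"
    and neg: "\<And>x. 0 < x \<Longrightarrow> x < b \<Longrightarrow> f x < 0 \<Longrightarrow> 0 \<le> f' x"
    and x: "0 < x" "x < b"
  shows "0 \<le> f x"
proof (rule ccontr)
  assume "\<not> 0 \<le> f x"
  then have fx: "f x < 0" by simp
  have mono: "f t \<le> f x" if t: "0 < t" "t < x" for t
  proof (rule ccontr)
    assume "\<not> f t \<le> f x"
    \<comment> \<open>A negative level above \<open>f x\<close> and at most \<open>f t\<close>. To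
      the right of the last point \<open>s\<close> where \<open>f\<close> reaches \<open>c\<close>,
      \<open>f\<close> is negative, hence nondecreasing, so
      \<open>c \<le> f s \<le> f x < c\<close>.\<close>
    define c where "c = min (f t) (f x / 2)"
    have c: "f x < c" "c < 0" "c \<le> f t"
      using \<open>\<not> f t \<le> f x\<close> fx by (auto simp: c_def)
    have cont: "continuous_on {t..x} f"
      by (intro continuous_at_imp_continuous_on ballI DERIV_isCont[OF deriv]) (use t x in auto)
    define S where "S = {s \<in> {t..x}. c \<le> f s}"
    have "compact S"
    proof -
      have "closed S" unfolding S_def using cont
        by (intro continuous_on_closed_Collect_le) auto
      moreover have "bounded S" unfolding S_def by (rule bounded_subset[of "{t..x}"]) auto
      ultimately show ?thesis by (simp add: compact_eq_bounded_closed)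
    qed
    moreover have "t \<in> S" using t c by (simp add: S_def)
    ultimately obtain s where s: "s \<in> S" "\<And>u. u \<in> S \<Longrightarrow> u \<le> s"
      using compact_attains_sup[of S] by blast
    have sx: "t \<le> s" "s < x" using s(1) c by (auto simp: S_def less_eq_real_def)
    have "f s \<le> f x"
    proof (rule DERIV_nonneg_imp_increasing_open[of s x f])
      fix u assume u: "s < u" "u < x"
      then have "\<not> c \<le> f u" using s(2)[of u] sx by (auto simp: S_def)
      then have "f u < 0" using c by linarith
      then show "\<exists>y. DERIV f u :> y \<and> 0 \<le> y"
        using deriv[of u] neg[of u] u sx t x by auto
    qed (use sx cont in \<open>auto intro: continuous_on_subset\<close>)
    then show False using s(1) c by (simp add: S_def)
  qed
  have "0 \<le> f x"
  proof (rule tendsto_upperbound[OF lim])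
    show "\<forall>\<^sub>F t in at_right 0. f t \<le> f x"
      unfolding eventually_at_right_field using x mono by (intro exI[of _ x]) auto
  qed simp
  then show False using fx by simp
qed

section \<open>The moment ratio and the convexity defect\<close>

definition moment_ratio :: "real \<Rightarrow> nat \<Rightarrow> real \<Rightarrow> real" where
  "moment_ratio a k x = weight_moment a k x / (x ^ k * weight_moment a 0 x)"

text \<open>This is \<open>Q\<close>. The subtracted bracket is \<open>D \<rho>\<close>, that is
  \<open>x\<close> times the derivative of \<open>moment_ratio\<close>.\<close>

definition convexity_defect :: "real \<Rightarrow> nat \<Rightarrow> real \<Rightarrow> real" where
  "convexity_defect a k x = mass_log_deriv2 a x * moment_ratio a k x * (1 - moment_ratio a k x) - (mass_log_deriv a x * (1 - moment_ratio a k x) - k * moment_ratio a k x)"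

lemma mass_log_deriv_has_derivative:
  assumes x: "0 < x" "x < 1"
  shows "(mass_log_deriv a has_real_derivative mass_log_deriv a x * mass_log_deriv2 a x / x) (at x)"
proof -
  define F where "F = weight_moment a 0 x"
  define w where "w = (1 - x) powr (-a)"
  have F: "0 < F" using weight_moment_pos x by (simp add: F_def)
  have w: "(1 - x) powr (- a - 1) = w / (1 - x)"
    using x by (simp add: w_def powr_diff)
  have dF: "(weight_moment a 0 has_real_derivative w) (at x)"
    using weight_moment_has_derivative[OF x, of a 0] by (simp add: w_def)
  have dw: "((\<lambda>x. (1 - x) powr (-a)) has_real_derivative a * w / (1 - x)) (at x)"
    using x w by (auto intro!: derivative_eq_intros)
  have "((\<lambda>x. x * (1 - x) powr (-a) / weight_moment a 0 x) has_real_derivative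
      ((1 * w + a * w / (1 - x) * x) * F - x * w * w) / (F * F)) (at x)"
    using F unfolding F_def w_def
    by (intro DERIV_divide DERIV_mult DERIV_ident dF[unfolded w_def] dw[unfolded w_def]) auto
  moreover have "((1 * w + a * w / (1 - x) * x) * F - x * w * w) / (F * F) = mass_log_deriv a x * mass_log_deriv2 a x / x"
    using F x unfolding mass_log_deriv2_def mass_log_deriv_def F_def[symmetric] w_def[symmetric]
    by (simp add: field_simps)
  ultimately show ?thesis unfolding mass_log_deriv_def[abs_def] by simp
qed

lemma moment_ratio_has_derivative:
  assumes x: "0 < x" "x < 1"
  shows "(moment_ratio a k has_real_derivative (mass_log_deriv a x * (1 - moment_ratio a k x) - k * moment_ratio a k x) / x) (at x)"
proof -
  define F where "F = weight_moment a 0 x"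
  define H where "H = weight_moment a k x"
  define w where "w = (1 - x) powr (-a)"
  have F: "0 < F" using weight_moment_pos x by (simp add: F_def)
  have dF: "(weight_moment a 0 has_real_derivative w) (at x)"
    using weight_moment_has_derivative[OF x, of a 0] by (simp add: w_def)
  have dH: "(weight_moment a k has_real_derivative x ^ k * w) (at x)"
    using weight_moment_has_derivative[OF x, of a k] by (simp add: w_def)
  have dp: "((\<lambda>x. x ^ k) has_real_derivative k * x ^ k / x) (at x)"
    using x by (auto intro!: derivative_eq_intros simp: power_diff) (cases k; simp)
  have "((\<lambda>x. weight_moment a k x / (x ^ k * weight_moment a 0 x)) has_real_derivative
      (x ^ k * w * (x ^ k * F) - H * (k * x ^ k / x * F + w * x ^ k)) / ((x ^ k * F) * (x ^ k * F))) (at x)"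
    using F x unfolding F_def H_def
    by (intro DERIV_divide DERIV_mult dH dF dp) auto
  moreover have "(x ^ k * w * (x ^ k * F) - H * (k * x ^ k / x * F + w * x ^ k)) / ((x ^ k * F) * (x ^ k * F))
      = (mass_log_deriv a x * (1 - moment_ratio a k x) - k * moment_ratio a k x) / x"
    using F x unfolding mass_log_deriv_def moment_ratio_def F_def[symmetric] w_def[symmetric] H_def[symmetric]
    by (simp add: field_simps)
  ultimately show ?thesis unfolding moment_ratio_def[abs_def] by simp
qed

lemma mass_log_deriv2_has_derivative:
  assumes x: "0 < x" "x < 1"
  shows "(mass_log_deriv2 a has_real_derivative mass_log_deriv3 a x / x) (at x)"
proof -
  have "((\<lambda>x. a * x / (1 - x)) has_real_derivative a / (1 - x)\<^sup>2) (at x)"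
    using x by (auto intro!: derivative_eq_intros simp: power2_eq_square) (simp add: algebra_simps)
  then have "((\<lambda>x. 1 + a * x / (1 - x) - mass_log_deriv a x) has_real_derivative
      0 + a / (1 - x)\<^sup>2 - mass_log_deriv a x * mass_log_deriv2 a x / x) (at x)"
    by (intro DERIV_diff DERIV_add DERIV_const mass_log_deriv_has_derivative x)
  moreover have "0 + a / (1 - x)\<^sup>2 - mass_log_deriv a x * mass_log_deriv2 a x / x = mass_log_deriv3 a x / x"
    using x by (simp add: mass_log_deriv3_def diff_divide_distrib)
  ultimately show ?thesis unfolding mass_log_deriv2_def[abs_def] by simp
qed

text \<open>The derivative is arranged as a multiple of \<open>Q\<close> plus a term with the
  nonnegative factor \<open>r * (1 - r)\<close>, ready for use where \<open>Q < 0\<close>.\<close>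

lemma convexity_defect_has_derivative:
  fixes a x :: real and k :: nat
  assumes x: "0 < x" "x < 1"
  defines "r \<equiv> moment_ratio a k x"
  shows "(convexity_defect a k has_real_derivative
     (r * (1 - r) * (mass_log_deriv3 a x - r * (mass_log_deriv2 a x)\<^sup>2) -
      convexity_defect a k x * (mass_log_deriv a x + k - mass_log_deriv2 a x * r)) / x) (at x)"
proof -
  define G where "G = mass_log_deriv a x"
  define E where "E = mass_log_deriv2 a x"
  define D where "D = mass_log_deriv3 a x"
  define S where "S = G * (1 - r) - k * r"
  have dG: "(mass_log_deriv a has_real_derivative G * E / x) (at x)"
    using mass_log_deriv_has_derivative[OF x, of a] by (simp add: G_def E_def)
  have dE: "(mass_log_deriv2 a has_real_derivative D / x) (at x)"
    using mass_log_deriv2_has_derivative[OF x, of a] by (simp add: D_def)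
  have dr: "(moment_ratio a k has_real_derivative S / x) (at x)"
    using moment_ratio_has_derivative[OF x, of a k] by (simp add: S_def G_def r_def)
  have "(convexity_defect a k has_real_derivative
      ((D / x * r + S / x * E) * (1 - r) + (0 - S / x) * (E * r)) -
      ((G * E / x * (1 - r) + (0 - S / x) * G) - (0 * r + S / x * k))) (at x)"
    unfolding convexity_defect_def[abs_def] G_def E_def r_def
    by (intro DERIV_diff DERIV_mult DERIV_const dG[unfolded G_def E_def] dE dr)
  moreover have "((D / x * r + S / x * E) * (1 - r) + (0 - S / x) * (E * r)) -
      ((G * E / x * (1 - r) + (0 - S / x) * G) - (0 * r + S / x * k)) =
     (r * (1 - r) * (D - r * E\<^sup>2) - (E * r * (1 - r) - S) * (G + k - E * r)) / x"
    using x unfolding S_def by (simp add: field_simps power2_eq_square)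
  moreover have "convexity_defect a k x = E * r * (1 - r) - S"
    by (simp add: convexity_defect_def E_def G_def r_def S_def)
  ultimately show ?thesis by (simp add: G_def E_def D_def)
qed

lemma moment_ratio_pos: "0 < x \<Longrightarrow> x < 1 \<Longrightarrow> 0 < moment_ratio a k x"
  using weight_moment_pos[of x a] by (simp add: moment_ratio_def)

lemma moment_ratio_le_1:
  assumes x: "0 < x" "x < 1"
  shows "moment_ratio a k x \<le> 1"
proof -
  have "weight_moment a k x \<le> integral {0..x} (\<lambda>s. x ^ k * (s ^ 0 * (1 - s) powr (-a)))"
    unfolding weight_moment_def
  proof (intro integral_le weight_moment_integrable x integrable_on_mult_right)
    fix s assume s: "s \<in> {0..x}"
    have "s ^ k * (1 - s) powr (-a) \<le> x ^ k * (1 - s) powr (-a)"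
      using s by (intro mult_right_mono power_mono) auto
    then show "s ^ k * (1 - s) powr (-a) \<le> x ^ k * (s ^ 0 * (1 - s) powr (-a))" by simp
  qed
  also have "\<dots> = x ^ k * weight_moment a 0 x" by (simp only: integral_mult_right weight_moment_def)
  finally show ?thesis using weight_moment_pos[OF x] x by (simp add: moment_ratio_def)
qed

lemma mass_log_deriv_tendsto: assumes "0 \<le> a" shows "(mass_log_deriv a \<longlongrightarrow> 1) (at_right 0)"
proof (rule tendsto_sandwich)
  show "\<forall>\<^sub>F x in at_right 0. 1 \<le> mass_log_deriv a x"
    unfolding eventually_at_right_field using assms mass_log_deriv_ge_1 by (intro exI[of _ 1]) auto
  show "\<forall>\<^sub>F x in at_right 0. mass_log_deriv a x \<le> (1 - x) powr (-a)"
    unfolding eventually_at_right_field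
  proof (intro exI[of _ 1] conjI allI impI)
    fix x :: real assume x: "0 < x" "x < 1"
    have "x * (1 - x) powr (-a) \<le> weight_moment a 0 x * (1 - x) powr (-a)"
      using weight_moment_bounds(1)[of x a 0] x assms by (intro mult_right_mono) auto
    then show "mass_log_deriv a x \<le> (1 - x) powr (-a)"
      using weight_moment_pos[OF x, of a 0] by (simp add: mass_log_deriv_def pos_divide_le_eq mult.commute)
  qed simp
  have "((\<lambda>x::real. (1 - x) powr (-a)) \<longlongrightarrow> (1 - 0) powr (-a)) (at_right 0)"
    by (intro tendsto_intros) auto
  then show "((\<lambda>x::real. (1 - x) powr (-a)) \<longlongrightarrow> 1) (at_right 0)" by simp
qed simp

lemma moment_ratio_tendsto: assumes "0 \<le> a" shows "(moment_ratio a k \<longlongrightarrow> 1 / Suc k) (at_right 0)"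
proof (rule tendsto_sandwich)
  let ?w = "\<lambda>x::real. (1 - x) powr (-a)"
  have ev: "\<forall>\<^sub>F x in at_right 0. 1 / Suc k / ?w x \<le> moment_ratio a k x \<and> moment_ratio a k x \<le> 1 / Suc k * ?w x"
    unfolding eventually_at_right_field
  proof (intro exI[of _ 1] conjI allI impI)
    fix x :: real assume x: "0 < x" "x < 1"
    note b = weight_moment_bounds[of x a, OF _ x(2) assms] weight_moment_pos[OF x, of a]
    have F: "x \<le> weight_moment a 0 x" "weight_moment a 0 x \<le> x * ?w x" using b(1)[of 0] b(2)[of 0] x by auto
    have w: "0 < ?w x" using x by simp
    have "x ^ Suc k / Suc k / (x ^ k * (x * ?w x)) \<le> weight_moment a k x / (x ^ k * weight_moment a 0 x)"
      using x F b(3) w by (intro frac_le mult_left_mono b) (auto intro!: mult_pos_pos less_imp_le[OF b(3)])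
    then show "1 / Suc k / ?w x \<le> moment_ratio a k x" using x by (simp add: moment_ratio_def)
    have "weight_moment a k x / (x ^ k * weight_moment a 0 x) \<le> x ^ Suc k / Suc k * ?w x / (x ^ k * x)"
      using x F b(3) w by (intro frac_le mult_left_mono b) (auto intro!: mult_pos_pos)
    then show "moment_ratio a k x \<le> 1 / Suc k * ?w x" using x by (simp add: moment_ratio_def)
  qed simp
  show "\<forall>\<^sub>F x in at_right 0. 1 / Suc k / ?w x \<le> moment_ratio a k x"
    "\<forall>\<^sub>F x in at_right 0. moment_ratio a k x \<le> 1 / Suc k * ?w x"
    using ev by (auto elim: eventually_mono)
  have "((\<lambda>x. 1 / Suc k / ?w x) \<longlongrightarrow> 1 / Suc k / (1 - 0) powr (-a)) (at_right 0)"
    "((\<lambda>x. 1 / Suc k * ?w x) \<longlongrightarrow> 1 / Suc k * (1 - 0) powr (-a)) (at_right 0)"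
    by (intro tendsto_intros; simp)+
  then show "((\<lambda>x. 1 / Suc k / ?w x) \<longlongrightarrow> 1 / Suc k) (at_right 0)"
    "((\<lambda>x. 1 / Suc k * ?w x) \<longlongrightarrow> 1 / Suc k) (at_right 0)" by simp_all
qed

text \<open>In the limit \<open>G = 1\<close>, \<open>E = 0\<close> and
  \<open>\<rho> = 1 / (k + 1)\<close>, so that \<open>D \<rho>\<close> vanishes as well.\<close>

lemma convexity_defect_tendsto: assumes "0 \<le> a" shows "(convexity_defect a k \<longlongrightarrow> 0) (at_right 0)"
proof -
  have E: "(mass_log_deriv2 a \<longlongrightarrow> 1 + a * 0 / (1 - 0) - 1) (at_right 0)"
    unfolding mass_log_deriv2_def[abs_def] by (intro tendsto_intros mass_log_deriv_tendsto assms) auto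
  have "(convexity_defect a k \<longlongrightarrow> (1 + a * 0 / (1 - 0) - 1) * (1 / Suc k) * (1 - 1 / Suc k)
      - (1 * (1 - 1 / Suc k) - k * (1 / Suc k))) (at_right 0)"
    unfolding convexity_defect_def[abs_def] by (intro tendsto_intros E mass_log_deriv_tendsto moment_ratio_tendsto assms)
  moreover have "(1 + a * 0 / (1 - 0) - 1) * (1 / Suc k) * (1 - 1 / Suc k)
      - (1 * (1 - 1 / Suc k) - k * (1 / Suc k)) = 0"
    by (simp add: field_simps)
  ultimately show ?thesis by simp
qed

lemma convexity_defect_nonneg:
  assumes a: "0 \<le> a" "a \<le> 3" and k: "0 < k" and x: "0 < x" "x < 1"
  shows "0 \<le> convexity_defect a k x"
proof (rule nonneg_of_deriv_nonneg_when_neg[OF convexity_defect_has_derivative convexity_defect_tendsto[OF a(1)] _ x])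
  fix x :: real assume x: "0 < x" "x < 1" and Q: "convexity_defect a k x < 0"
  define G where "G = mass_log_deriv a x"
  define E where "E = mass_log_deriv2 a x"
  define D where "D = mass_log_deriv3 a x"
  define r where "r = moment_ratio a k x"
  have "r \<noteq> 1" using Q by (auto simp: convexity_defect_def r_def)
  then have r: "0 < r" "r < 1" using moment_ratio_pos[OF x, of a k] moment_ratio_le_1[OF x, of a k] by (auto simp: r_def)
  have G: "1 \<le> G" using mass_log_deriv_ge_1 x a by (simp add: G_def)
  have Q': "E * r * (1 - r) + k * r < G * (1 - r)"
    using Q by (simp add: convexity_defect_def E_def G_def r_def)
  \<comment> \<open>Dropping \<open>k * r\<close> yields the sign of \<open>G + k - E * r\<close>,
    the factor of \<open>Q\<close> in the derivative.\<close>
  have "E * r * (1 - r) < G * (1 - r)" using Q' r by (smt (verit) mult_nonneg_nonneg of_nat_0_le_iff)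
  then have Er: "E * r < G" using r by simp
  have "r * E\<^sup>2 \<le> D"
    using mass_log_deriv2_growth[OF a x, folded G_def E_def D_def]
  proof
    assume "E\<^sup>2 \<le> D"
    moreover have "r * E\<^sup>2 \<le> 1 * E\<^sup>2" using r by (intro mult_right_mono) auto
    ultimately show ?thesis by simp
  next
    assume growth: "0 < E \<and> 0 \<le> (E\<^sup>2 - D) * (D - G * E) + E * D"
    show ?thesis
    proof (rule ccontr)
      assume "\<not> r * E\<^sup>2 \<le> D"
      \<comment> \<open>The ratio at which \<open>r * E\<^sup>2\<close> would equal
        \<open>D\<close>. The growth inequality says that \<open>u * E - G + u / (1 - u)\<close> is
        nonnegative at \<open>u = c\<close>; \<open>Q < 0\<close> and \<open>k \<ge> 1\<close> make
        it negative at \<open>u = r\<close>. As it increases in \<open>u\<close>, this contradicts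
        \<open>c < r\<close>.\<close>
      define c where "c = D / E\<^sup>2"
      have E: "0 < E" using growth by simp
      have D: "D = c * E\<^sup>2" using E by (simp add: c_def)
      have cr: "c < r" using \<open>\<not> r * E\<^sup>2 \<le> D\<close> E by (simp add: D)
      have "0 \<le> E ^ 3 * ((1 - c) * (c * E - G) + c)"
        using growth by (simp add: D algebra_simps power2_eq_square power3_eq_cube)
      then have c_ineq: "0 \<le> (1 - c) * (c * E - G) + c" using E by (simp add: zero_le_mult_iff)
      have c1: "c < 1" using cr r by simp
      have "(1 - r) * (r * E - G) + r < 0"
      proof -
        have "1 * r \<le> k * r" using k r by (intro mult_right_mono) auto
        then show ?thesis using Q' by (simp add: algebra_simps)
      qed
      then have "(r * E - G) < - (r / (1 - r))" using r by (simp add: field_simps)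
      moreover have "- (c / (1 - c)) \<le> c * E - G" using c_ineq c1 by (simp add: field_simps)
      moreover have "c / (1 - c) \<le> r / (1 - r)" using cr c1 r by (simp add: divide_simps) (simp add: algebra_simps)
      moreover have "c * E \<le> r * E" using cr E by (intro mult_right_mono) auto
      ultimately show False by linarith
    qed
  qed
  then have "0 \<le> r * (1 - r) * (D - r * E\<^sup>2)" using r by simp
  moreover have "convexity_defect a k x * (G + k - E * r) \<le> 0" using Q Er by (intro mult_nonpos_nonneg) auto
  ultimately show "0 \<le> (moment_ratio a k x * (1 - moment_ratio a k x) * (mass_log_deriv3 a x - moment_ratio a k x * (mass_log_deriv2 a x)\<^sup>2) -
      convexity_defect a k x * (mass_log_deriv a x + k - mass_log_deriv2 a x * moment_ratio a k x)) / x"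
    using x by (simp add: G_def E_def D_def r_def)
qed

text \<open>Since \<open>D log F\<^sub>k = G / \<rho>\<close>, the function is
  \<open>D log (F\<^sub>k / F\<^sub>0)\<close>; its derivative has the sign of \<open>Q\<close> when
  \<open>G > 0\<close>.\<close>

lemma log_slope_has_derivative:
  fixes a x :: real and k :: nat
  assumes x: "0 < x" "x < 1"
  shows "((\<lambda>x. mass_log_deriv a x / moment_ratio a k x - mass_log_deriv a x) has_real_derivative
     mass_log_deriv a x * convexity_defect a k x / (x * (moment_ratio a k x)\<^sup>2)) (at x)"
proof -
  define G where "G = mass_log_deriv a x"
  define E where "E = mass_log_deriv2 a x"
  define r where "r = moment_ratio a k x"
  define S where "S = G * (1 - r) - k * r"
  have r: "0 < r" using moment_ratio_pos x by (simp add: r_def)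
  have dG: "(mass_log_deriv a has_real_derivative G * E / x) (at x)"
    using mass_log_deriv_has_derivative[OF x, of a] by (simp add: G_def E_def)
  have dr: "(moment_ratio a k has_real_derivative S / x) (at x)"
    using moment_ratio_has_derivative[OF x, of a k] by (simp add: S_def G_def r_def)
  have "((\<lambda>x. mass_log_deriv a x / moment_ratio a k x - mass_log_deriv a x) has_real_derivative
      (G * E / x * r - G * (S / x)) / (r * r) - G * E / x) (at x)"
    unfolding G_def r_def
    by (intro DERIV_diff DERIV_divide dG[unfolded G_def] dr[unfolded r_def]) (use r in \<open>auto simp: r_def\<close>)
  moreover have "(G * E / x * r - G * (S / x)) / (r * r) - G * E / x = G * (E * r * (1 - r) - S) / (x * r\<^sup>2)"
    using r x by (simp add: divide_simps) (simp add: algebra_simps power2_eq_square)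
  moreover have "convexity_defect a k x = E * r * (1 - r) - S"
    by (simp add: convexity_defect_def E_def G_def r_def S_def)
  ultimately show ?thesis by (simp add: G_def r_def)
qed

text \<open>Here \<open>t = log r\<close> and \<open>x = exp (2 * t)\<close>, so
  \<open>d/dt = 2 D\<close> and the second derivative is \<open>4 G Q / \<rho>^2\<close>.\<close>

lemma monomial_mean_log_convex:
  assumes a: "0 \<le> a" "a \<le> 3"
  shows "convex_on {..<0} (\<lambda>t. ln (weight_moment a k (exp (2 * t)) / weight_moment a 0 (exp (2 * t))))"
proof (cases "k = 0")
  case True
  have "(\<lambda>t. ln (weight_moment a 0 (exp (2 * t)) / weight_moment a 0 (exp (2 * t)))) = (\<lambda>t. 0)"
    by (simp add: fun_eq_iff)
  then show ?thesis unfolding True by (simp only:) (simp add: convex_on_def)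
next
  case False
  then have k: "0 < k" by simp
  define x where "x t = exp (2 * t)" for t :: real
  have x: "0 < x t" "x t < 1" if "t \<in> {..<0}" for t using that by (auto simp: x_def)
  have dx: "(x has_real_derivative 2 * x t) (at t)" for t
    unfolding x_def[abs_def] by (auto intro!: derivative_eq_intros)
  define K where "K x = mass_log_deriv a x / moment_ratio a k x - mass_log_deriv a x" for x
  show ?thesis unfolding x_def[symmetric]
  proof (rule f''_ge0_imp_convex[where f' = "\<lambda>t. 2 * K (x t)"
        and f'' = "\<lambda>t. 2 * (mass_log_deriv a (x t) * convexity_defect a k (x t) / (x t * (moment_ratio a k (x t))\<^sup>2) * (2 * x t))"])
    fix t :: real assume t: "t \<in> {..<0}"
    note x = x[OF t]
    have pos: "0 < weight_moment a k (x t)" "0 < weight_moment a 0 (x t)" using weight_moment_pos[OF x] by auto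
    have d: "((\<lambda>t. weight_moment a j (x t)) has_real_derivative x t ^ j * (1 - x t) powr (-a) * (2 * x t)) (at t)" for j
      by (rule DERIV_chain2[OF weight_moment_has_derivative[OF x] dx])
    have d1: "((\<lambda>t. ln (weight_moment a k (x t)) - ln (weight_moment a 0 (x t))) has_real_derivative
        (1 / weight_moment a k (x t) * (x t ^ k * (1 - x t) powr (-a) * (2 * x t)) -
         1 / weight_moment a 0 (x t) * (x t ^ 0 * (1 - x t) powr (-a) * (2 * x t)))) (at t)"
      by (intro DERIV_diff DERIV_chain2[where f = ln, OF DERIV_ln_divide d] pos)
    have eq: "1 / weight_moment a k (x t) * (x t ^ k * (1 - x t) powr (-a) * (2 * x t)) -
         1 / weight_moment a 0 (x t) * (x t ^ 0 * (1 - x t) powr (-a) * (2 * x t)) = 2 * K (x t)"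
      using pos x unfolding K_def mass_log_deriv_def moment_ratio_def by (simp add: divide_simps)
    have ev: "\<forall>\<^sub>F u in nhds t. ln (weight_moment a k (x u) / weight_moment a 0 (x u)) = ln (weight_moment a k (x u)) - ln (weight_moment a 0 (x u))"
    proof -
      have "\<forall>\<^sub>F u in nhds t. u \<in> {..<0}" using t by (intro eventually_nhds_in_open) auto
      then show ?thesis
      proof eventually_elim
        case (elim u)
        have "0 < x u" "x u < 1" using elim by (auto simp: x_def)
        then show ?case using weight_moment_pos[of "x u" a k] weight_moment_pos[of "x u" a 0] by (simp add: ln_div)
      qed
    qed
    show "((\<lambda>t. ln (weight_moment a k (x t) / weight_moment a 0 (x t))) has_real_derivative 2 * K (x t)) (at t)"
      using d1 unfolding eq DERIV_cong_ev[OF refl ev refl] .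
    show "((\<lambda>t. 2 * K (x t)) has_real_derivative
        2 * (mass_log_deriv a (x t) * convexity_defect a k (x t) / (x t * (moment_ratio a k (x t))\<^sup>2) * (2 * x t))) (at t)"
      unfolding K_def
      by (intro DERIV_cmult DERIV_chain2[OF log_slope_has_derivative[OF x] dx])
    show "0 \<le> 2 * (mass_log_deriv a (x t) * convexity_defect a k (x t) / (x t * (moment_ratio a k (x t))\<^sup>2) * (2 * x t))"
      using mass_log_deriv_ge_1[OF a(1) x] convexity_defect_nonneg[OF a k x] x by simp
  qed simp
qed

subsection \<open>Logarithmically convex series\<close>

lemma convex_on_transform:
  assumes f: "convex_on S f" and eq: "\<And>x. x \<in> S \<Longrightarrow> f x = g x"
  shows "convex_on S g"
proof (rule convex_onI)
  show S: "convex S" using f by (rule convex_on_imp_convex)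
  fix t :: real and x y assume t: "0 < t" "t < 1" and xy: "x \<in> S" "y \<in> S"
  then have "(1 - t) *\<^sub>R x + t *\<^sub>R y \<in> S" using S by (intro convexD) auto
  then show "g ((1 - t) *\<^sub>R x + t *\<^sub>R y) \<le> (1 - t) * g x + t * g y"
    using convex_onD[OF f _ _ xy, of t] t xy eq by simp
qed

text \<open>The right-hand side is visibly stable under sums and limits.\<close>

lemma log_convex_iff:
  fixes \<phi> :: "real \<Rightarrow> real"
  assumes S: "convex S" and pos: "\<And>t. t \<in> S \<Longrightarrow> 0 < \<phi> t"
  shows "convex_on S (\<lambda>t. ln (\<phi> t)) \<longleftrightarrow> (\<forall>c. convex_on S (\<lambda>t. exp (c * t) * \<phi> t))"
proof safe
  fix c assume L: "convex_on S (\<lambda>t. ln (\<phi> t))"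
  have eq: "exp (c * t) * \<phi> t = exp (c * t + ln (\<phi> t))" if "t \<in> S" for t
    using pos[OF that] by (simp add: exp_add)
  show "convex_on S (\<lambda>t. exp (c * t) * \<phi> t)"
  proof (rule convex_onI[OF _ S])
    fix u x y :: real assume u: "0 < u" "u < 1" and xy: "x \<in> S" "y \<in> S"
    define m where "m = (1 - u) *\<^sub>R x + u *\<^sub>R y"
    have m: "m \<in> S" unfolding m_def using S xy u by (intro convexD) auto
    have "c * m + ln (\<phi> m) \<le> (1 - u) * (c * x + ln (\<phi> x)) + u * (c * y + ln (\<phi> y))"
      using convex_onD[OF L _ _ xy, of u] u by (simp add: m_def algebra_simps)
    then have "exp (c * m + ln (\<phi> m)) \<le> exp ((1 - u) *\<^sub>R (c * x + ln (\<phi> x)) + u *\<^sub>R (c * y + ln (\<phi> y)))"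
      by simp
    also have "\<dots> \<le> (1 - u) * exp (c * x + ln (\<phi> x)) + u * exp (c * y + ln (\<phi> y))"
      using u by (intro convex_onD[OF exp_convex]) auto
    finally show "exp (c * m) * \<phi> m \<le> (1 - u) * (exp (c * x) * \<phi> x) + u * (exp (c * y) * \<phi> y)"
      by (simp only: eq xy m)
  qed
next
  assume E: "\<forall>c. convex_on S (\<lambda>t. exp (c * t) * \<phi> t)"
  show "convex_on S (\<lambda>t. ln (\<phi> t))"
  proof (rule convex_on_linorderI[OF _ S])
    fix u x y :: real assume u: "0 < u" "u < 1" and xy: "x \<in> S" "y \<in> S" "x < y"
    define m where "m = (1 - u) *\<^sub>R x + u *\<^sub>R y"
    have m: "m \<in> S" unfolding m_def using S xy u by (intro convexD) auto
    \<comment> \<open>This slope gives \<open>c * t + ln (\<phi> t)\<close> the same value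
      \<open>K\<close> at \<open>x\<close> and \<open>y\<close>. The convexity bound then reads
      \<open>exp K\<close>, and taking logarithms loses nothing.\<close>
    define c where "c = (ln (\<phi> x) - ln (\<phi> y)) / (y - x)"
    define K where "K = c * x + ln (\<phi> x)"
    have "c * (y - x) = ln (\<phi> x) - ln (\<phi> y)" using xy by (simp add: c_def)
    then have K: "K = c * y + ln (\<phi> y)" by (simp add: K_def algebra_simps)
    have eq: "exp (c * t) * \<phi> t = exp (c * t + ln (\<phi> t))" if "t \<in> S" for t
      using pos[OF that] by (simp add: exp_add)
    have "exp (c * m) * \<phi> m \<le> (1 - u) * (exp (c * x) * \<phi> x) + u * (exp (c * y) * \<phi> y)"
      unfolding m_def using E u xy by (intro convex_onD[of S]) auto
    also have "\<dots> = (1 - u) * exp K + u * exp K" by (simp only: eq xy K_def[symmetric] K[symmetric])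
    also have "\<dots> = exp K" by (simp add: algebra_simps)
    finally have "c * m + ln (\<phi> m) \<le> K" by (simp add: eq m)
    also have "K = (1 - u) * (c * x + ln (\<phi> x)) + u * (c * y + ln (\<phi> y))"
      unfolding K_def[symmetric] K[symmetric] by (simp add: algebra_simps)
    finally show "ln (\<phi> m) \<le> (1 - u) * ln (\<phi> x) + u * ln (\<phi> y)"
      by (simp add: m_def algebra_simps)
  qed
qed

text \<open>The criterion of \<open>log_convex_iff\<close> is linear in \<open>\<phi>\<close>, so it
  holds for each term and passes to the sum.\<close>

lemma log_convex_sums:
  fixes h :: "nat \<Rightarrow> real \<Rightarrow> real"
  assumes S: "convex S" and b: "\<And>k. 0 \<le> b k"
    and h_pos: "\<And>k t. t \<in> S \<Longrightarrow> 0 < h k t"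
    and h_convex: "\<And>k. convex_on S (\<lambda>t. ln (h k t))"
    and sums: "\<And>t. t \<in> S \<Longrightarrow> (\<lambda>k. b k * h k t) sums \<phi> t"
    and \<phi>_pos: "\<And>t. t \<in> S \<Longrightarrow> 0 < \<phi> t"
  shows "convex_on S (\<lambda>t. ln (\<phi> t))"
proof -
  have "convex_on S (\<lambda>t. exp (c * t) * \<phi> t)" for c
  proof (rule convex_onI[OF _ S])
    fix u x y :: real assume u: "0 < u" "u < 1" and xy: "x \<in> S" "y \<in> S"
    define m where "m = (1 - u) *\<^sub>R x + u *\<^sub>R y"
    have m: "m \<in> S" unfolding m_def using S xy u by (intro convexD) auto
    have s: "(\<lambda>k. b k * (exp (c * t) * h k t)) sums (exp (c * t) * \<phi> t)" if "t \<in> S" for t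
      using sums_mult[OF sums[OF that], of "exp (c * t)"] by (simp add: ac_simps)
    show "exp (c * m) * \<phi> m \<le> (1 - u) * (exp (c * x) * \<phi> x) + u * (exp (c * y) * \<phi> y)"
    proof (rule sums_le[OF _ s[OF m]])
      show "(\<lambda>k. (1 - u) * (b k * (exp (c * x) * h k x)) + u * (b k * (exp (c * y) * h k y))) sums
          ((1 - u) * (exp (c * x) * \<phi> x) + u * (exp (c * y) * \<phi> y))"
        by (intro sums_add sums_mult s xy)
      fix k
      have "convex_on S (\<lambda>t. exp (c * t) * h k t)"
        using log_convex_iff[OF S, of "h k"] h_pos h_convex by blast
      from convex_onD[OF this _ _ xy, of u]
      have "exp (c * m) * h k m \<le> (1 - u) * (exp (c * x) * h k x) + u * (exp (c * y) * h k y)"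
        using u by (simp add: m_def)
      from mult_left_mono[OF this b]
      show "b k * (exp (c * m) * h k m) \<le>
          (1 - u) * (b k * (exp (c * x) * h k x)) + u * (b k * (exp (c * y) * h k y))"
        by (simp add: algebra_simps)
    qed
  qed
  then show ?thesis using log_convex_iff[OF S, of \<phi>] \<phi>_pos by blast
qed

subsection \<open>Area integrals of power series\<close>

text \<open>
  Uniqueness of Haar measure in miniature: with \<open>B\<close> the unit disc, integrate \<open>1\<^sub>B(u) 1\<^sub>A(u + c y)\<close> over \<open>(u, y)\<close> in both
  orders; translation invariance and \<open>c B = B\<close> give \<open>|B| |c\<inverse> A| = |B| |A|\<close>.
\<close>

lemma lborel_distr_rotation:
  fixes c :: complex
  assumes c: "norm c = 1"
  shows "distr lborel borel ((*) c) = lborel"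
proof (rule measure_eqI)
  fix A assume "A \<in> sets (distr lborel borel ((*) c))"
  then have A [measurable]: "A \<in> sets borel" by simp
  define B where "B = ball (0 :: complex) 1"
  have B [measurable]: "B \<in> sets borel" by (simp add: B_def)
  define \<beta> where "\<beta> = emeasure lborel B"
  have \<beta>: "\<beta> \<noteq> 0" "\<beta> \<noteq> \<infinity>"
    by (simp_all add: \<beta>_def B_def emeasure_ball eval_unit_ball_vol)
  have c0: "c \<noteq> 0" using c by auto
  have trans: "(\<integral>\<^sup>+z. f (b + z) \<partial>lborel) = (\<integral>\<^sup>+z. f z \<partial>lborel)"
    if [measurable]: "f \<in> borel_measurable borel" for f :: "complex \<Rightarrow> ennreal" and b
    by (subst (2) lborel_distr_plus[of b, symmetric]) (simp add: nn_integral_distr)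
  \<comment> \<open>Rotation invariance of \<open>B\<close> turns the condition into membership of a
    translate of \<open>y\<close>, so that the integral over \<open>y\<close> is
    \<open>\<beta>\<close> for every \<open>u\<close>.\<close>
  have norm_eq: "(u - c * y \<in> B) = (- (u / c) + y \<in> B)" for u y
  proof -
    have "u - c * y = - c * (- (u / c) + y)" using c0 by (simp add: field_simps)
    then have "norm (u - c * y) = norm (- (u / c) + y)" using c by (simp add: norm_mult del: mult_minus_left)
    then show ?thesis by (simp add: B_def)
  qed
  have "\<beta> * emeasure (distr lborel borel ((*) c)) A =
      (\<integral>\<^sup>+u. indicator B u * (\<integral>\<^sup>+y. indicator A (c * y) \<partial>lborel) \<partial>lborel)"
  proof -
    have "emeasure (distr lborel borel ((*) c)) A = (\<integral>\<^sup>+y. indicator A y \<partial>(distr lborel borel ((*) c)))"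
      by (simp add: nn_integral_indicator)
    also have "\<dots> = (\<integral>\<^sup>+y. indicator A (c * y) \<partial>lborel)"
      by (subst nn_integral_distr) auto
    finally show ?thesis
      by (simp add: nn_integral_multc \<beta>_def)
  qed
  also have "\<dots> = (\<integral>\<^sup>+u. \<integral>\<^sup>+y. indicator B u * indicator A (u + c * y) \<partial>lborel \<partial>lborel)"
  proof (rule nn_integral_cong)
    fix u :: complex
    have "(\<integral>\<^sup>+y. indicator A (c * y) \<partial>lborel) = (\<integral>\<^sup>+y. indicator A (c * (u / c + y)) \<partial>lborel)"
      by (rule trans[symmetric]) simp
    also have "\<dots> = (\<integral>\<^sup>+y. indicator A (u + c * y) \<partial>lborel)"
      using c0 by (simp add: distrib_left)
    finally show "indicator B u * (\<integral>\<^sup>+y. indicator A (c * y) \<partial>lborel) =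
        (\<integral>\<^sup>+y. indicator B u * indicator A (u + c * y) \<partial>lborel)"
      by (simp add: nn_integral_cmult)
  qed
  also have "\<dots> = (\<integral>\<^sup>+y. \<integral>\<^sup>+u. indicator B u * indicator A (u + c * y) \<partial>lborel \<partial>lborel)"
    by (rule lborel_pair.Fubini') simp
  also have "\<dots> = (\<integral>\<^sup>+y. \<integral>\<^sup>+u. indicator B (u - c * y) * indicator A u \<partial>lborel \<partial>lborel)"
  proof (rule nn_integral_cong)
    fix y :: complex
    have "(\<integral>\<^sup>+u. indicator B (- (c * y) + u) * indicator A (c * y + (- (c * y) + u)) \<partial>lborel) =
        (\<integral>\<^sup>+u. indicator B u * indicator A (c * y + u) \<partial>lborel)"
      by (rule trans) simp
    then show "(\<integral>\<^sup>+u. indicator B u * indicator A (u + c * y) \<partial>lborel) =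
        (\<integral>\<^sup>+u. indicator B (u - c * y) * indicator A u \<partial>lborel)"
      by (simp add: add.commute)
  qed
  also have "\<dots> = (\<integral>\<^sup>+u. \<integral>\<^sup>+y. indicator B (u - c * y) * indicator A u \<partial>lborel \<partial>lborel)"
    by (rule lborel_pair.Fubini'[symmetric]) simp
  also have "\<dots> = (\<integral>\<^sup>+u. \<beta> * indicator A u \<partial>lborel)"
  proof (rule nn_integral_cong)
    fix u :: complex
    have "(\<integral>\<^sup>+y. indicator B (u - c * y) \<partial>lborel) = (\<integral>\<^sup>+y. indicator B (- (u / c) + y) \<partial>lborel)"
      using norm_eq by (intro nn_integral_cong) (simp add: indicator_def)
    also have "\<dots> = \<beta>" by (subst trans) (simp_all add: \<beta>_def)
    finally show "(\<integral>\<^sup>+y. indicator B (u - c * y) * indicator A u \<partial>lborel) = \<beta> * indicator A u"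
      by (simp add: nn_integral_multc)
  qed
  also have "\<dots> = \<beta> * emeasure lborel A" by (simp add: nn_integral_cmult)
  finally show "emeasure (distr lborel borel ((*) c)) A = emeasure lborel A"
    using \<beta> by (simp add: ennreal_mult_cancel_left)
qed simp

text \<open>Polar coordinates for radial functions: the rays \<open>{x<..}\<close> determine the
  measure, and their preimages are discs or annuli of known area.\<close>

lemma distr_norm_square_ball:
  fixes R :: real
  assumes R: "0 < R"
  shows "distr (density lborel (indicator (ball (0 :: complex) R))) borel (\<lambda>z. (norm z)\<^sup>2) =
     density lborel (\<lambda>s. ennreal (pi * indicator {0..<R\<^sup>2} s))" (is "?M = ?N")
proof (rule measure_eqI_lessThan)
  fix x :: real
  have "emeasure ?M {x<..} = emeasure lborel (ball (0 :: complex) R \<inter> {z. x < (norm z)\<^sup>2})"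
    by (simp add: emeasure_distr vimage_def emeasure_restricted)
  \<comment> \<open>Clamping \<open>x\<close> to the interval from 0 to \<open>R\<^sup>2\<close>
    lets one formula cover every position of the ray.\<close>
  also have "\<dots> = ennreal (pi * (R\<^sup>2 - max 0 (min x (R\<^sup>2))))"
  proof (cases "0 \<le> x")
    case True
    define q where "q = sqrt x"
    have q: "0 \<le> q" "x = q\<^sup>2" using True by (auto simp: q_def)
    have less_iff: "x < (norm z)\<^sup>2 \<longleftrightarrow> q < norm z" for z :: complex
      using power_mono_iff[of "norm z" q 2] q by (simp add: not_le[symmetric])
    show ?thesis
    proof (cases "q < R")
      case True
      have "ball (0 :: complex) R \<inter> {z. x < (norm z)\<^sup>2} = ball 0 R - cball 0 q"
        by (auto simp: less_iff)
      also have "emeasure lborel \<dots> = emeasure lborel (ball (0 :: complex) R) - emeasure lborel (cball (0 :: complex) q)"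
        using True by (intro emeasure_Diff) (auto simp: emeasure_cball q)
      also have "\<dots> = ennreal (pi * R\<^sup>2 - pi * q\<^sup>2)"
        using q R by (simp add: emeasure_cball emeasure_ball eval_unit_ball_vol ennreal_minus)
      finally show ?thesis using q True by (simp add: q min_def right_diff_distrib power_mono)
    next
      case False
      then have "R\<^sup>2 \<le> q\<^sup>2" using R by (intro power_mono) auto
      moreover have "ball (0 :: complex) R \<inter> {z. x < (norm z)\<^sup>2} = {}"
        using False by (auto simp: less_iff)
      ultimately show ?thesis using R q by (simp add: min_def)
    qed
  next
    case False
    then have "ball (0 :: complex) R \<inter> {z. x < (norm z)\<^sup>2} = ball 0 R"
      by (auto simp: not_le intro: less_le_trans)
    then show ?thesis using False R by (simp add: emeasure_ball eval_unit_ball_vol)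
  qed
  finally have M: "emeasure ?M {x<..} = ennreal (pi * (R\<^sup>2 - max 0 (min x (R\<^sup>2))))" .
  then show "emeasure ?M {x<..} < \<infinity>" by simp
  have "emeasure ?N {x<..} = ennreal (pi * (R\<^sup>2 - max 0 (min x (R\<^sup>2))))"
  proof -
    have "emeasure ?N {x<..} = (\<integral>\<^sup>+s. ennreal pi * indicator ({0..<R\<^sup>2} \<inter> {x<..}) s \<partial>lborel)"
      by (subst emeasure_density) (auto intro!: nn_integral_cong split: split_indicator)
    also have "\<dots> = ennreal pi * emeasure lborel ({0..<R\<^sup>2} \<inter> {x<..})"
      by (simp add: nn_integral_cmult)
    also have "emeasure lborel ({0..<R\<^sup>2} \<inter> {x<..}) = ennreal (R\<^sup>2 - max 0 (min x (R\<^sup>2)))"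
    proof (cases "0 \<le> x")
      case True
      then have "{0..<R\<^sup>2} \<inter> {x<..} = {x<..<R\<^sup>2}" by auto
      then show ?thesis using True by (cases "x \<le> R\<^sup>2") auto
    next
      case False
      then have "{0..<R\<^sup>2} \<inter> {x<..} = {0..<R\<^sup>2}" by auto
      then show ?thesis using False by simp
    qed
    finally show ?thesis by (simp add: ennreal_mult')
  qed
  then show "emeasure ?M {x<..} = emeasure ?N {x<..}" using M by simp
qed simp_all

lemma radial_moment:
  fixes r a :: real
  assumes r: "0 < r" "r < 1"
  shows "(LINT z:ball (0 :: complex) r|lborel. (1 - (norm z)\<^sup>2) powr (-a) * (norm z) ^ (2 * k)) = pi * weight_moment a k (r\<^sup>2)"
proof -
  define h where "h s = s ^ k * (1 - s) powr (-a)" for s :: real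
  have h [measurable]: "h \<in> borel_measurable borel" unfolding h_def by measurable
  have r2: "r\<^sup>2 < 1" using r by (simp add: power_less_one_iff)
  have "(LINT z:ball (0 :: complex) r|lborel. (1 - (norm z)\<^sup>2) powr (-a) * (norm z) ^ (2 * k)) =
      (LINT z:ball (0 :: complex) r|lborel. h ((norm z)\<^sup>2))"
    by (simp only: h_def power_mult mult.commute[of "_ powr _"])
  also have "\<dots> = (LINT z|density lborel (\<lambda>z. ennreal (indicator (ball (0 :: complex) r) z)). h ((norm z)\<^sup>2))"
    unfolding set_lebesgue_integral_def by (subst integral_density) (auto intro!: borel_measurable_indicator)
  also have "\<dots> = (LINT s|distr (density lborel (indicator (ball (0 :: complex) r))) borel (\<lambda>z. (norm z)\<^sup>2). h s)"
    by (subst integral_distr) (simp_all add: ennreal_indicator)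
  also have "\<dots> = (LINT s|density lborel (\<lambda>s. ennreal (pi * indicator {0..<r\<^sup>2} s)). h s)"
    by (simp only: distr_norm_square_ball[OF r(1)])
  also have "\<dots> = pi * (LINT s:{0..<r\<^sup>2}|lborel. h s)"
    unfolding set_lebesgue_integral_def by (subst integral_density) (auto simp: mult.assoc intro!: borel_measurable_indicator)
  also have "(LINT s:{0..<r\<^sup>2}|lborel. h s) = integral {0..<r\<^sup>2} h"
  proof (rule set_borel_integral_eq_integral)
    have "continuous_on {0..r\<^sup>2} h" unfolding h_def using r2 by (intro continuous_intros) auto
    then have "set_integrable lborel {0..r\<^sup>2} h"
      unfolding set_integrable_def by (intro borel_integrable_compact) auto
    then show "set_integrable lborel {0..<r\<^sup>2} h" by (rule set_integrable_subset) auto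
  qed
  \<comment> \<open>The open ball leads to a half-open interval, while \<open>weight_moment\<close>
    uses the closed one; they differ by a null set.\<close>
  also have "integral {0..<r\<^sup>2} h = integral {0..r\<^sup>2} h"
    by (rule integral_spike_set) (auto intro: negligible_subset[of "{r\<^sup>2}"])
  finally show ?thesis by (simp add: weight_moment_def h_def[abs_def])
qed

section \<open>Orthogonality of monomials and Parseval's identity on discs\<close>

lemma set_integrable_ball_continuous:
  fixes F :: "complex \<Rightarrow> 'b::{banach, second_countable_topology}"
  assumes "continuous_on (cball 0 r) F"
  shows "set_integrable lborel (ball 0 r) F"
proof -
  have "set_integrable lborel (cball 0 r) F"
    unfolding set_integrable_def using assms by (intro borel_integrable_compact) auto
  then show ?thesis by (rule set_integrable_subset) auto
qed

lemma continuous_on_weight: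
  assumes "r < 1"
  shows "continuous_on (cball (0 :: complex) r) (\<lambda>z. (1 - (norm z)\<^sup>2) powr (-a))"
proof (intro continuous_intros ballI)
  fix z :: complex assume "z \<in> cball 0 r"
  then have "norm z < 1" using assms by simp
  then show "1 - (norm z)\<^sup>2 \<noteq> 0" using power_less_one_iff[of "norm z" 2] by simp
qed

text \<open>For \<open>j \<noteq> k\<close> a suitable rotation changes the sign of the integrand,
  so the integral equals its own negative. For \<open>j = k\<close> it is a radial moment.\<close>

lemma weighted_orthogonality:
  fixes r a :: real
  assumes r: "0 < r" "r < 1"
  shows "(LINT z:ball (0 :: complex) r|lborel. of_real ((1 - (norm z)\<^sup>2) powr (-a)) * (z ^ j * cnj z ^ k)) =
     (if j = k then of_real (pi * weight_moment a k (r\<^sup>2)) else 0)"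
proof (cases "j = k")
  case True
  have norm_eq: "z ^ k * cnj z ^ k = complex_of_real ((norm z) ^ (2 * k))" for z
  proof -
    have "complex_of_real ((norm z) ^ (2 * k)) = (complex_of_real ((norm z)\<^sup>2)) ^ k"
      by (simp add: power_mult)
    then show ?thesis by (simp only: complex_norm_square power_mult_distrib)
  qed
  have "(LINT z:ball (0 :: complex) r|lborel. of_real ((1 - (norm z)\<^sup>2) powr (-a)) * (z ^ j * cnj z ^ k)) =
      (LINT z:ball (0 :: complex) r|lborel. complex_of_real ((1 - (norm z)\<^sup>2) powr (-a) * (norm z) ^ (2 * k)))"
    unfolding True norm_eq of_real_mult ..
  also have "\<dots> = of_real (LINT z:ball (0 :: complex) r|lborel. (1 - (norm z)\<^sup>2) powr (-a) * (norm z) ^ (2 * k))"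
    by (rule set_integral_complex_of_real)
  finally show ?thesis using True radial_moment[OF r] by simp
next
  case False
  define F where "F z = indicator (ball 0 r) z *\<^sub>R
     (complex_of_real ((1 - (norm z)\<^sup>2) powr (-a)) * (z ^ j * cnj z ^ k))" for z
  have F [measurable]: "F \<in> borel_measurable borel"
  proof -
    have "continuous_on (ball 0 r) (\<lambda>z. complex_of_real ((1 - (norm z)\<^sup>2) powr (-a)) * (z ^ j * cnj z ^ k))"
      by (intro continuous_intros continuous_on_subset[OF continuous_on_weight[OF r(2)]]) auto
    then show ?thesis unfolding F_def[abs_def] by (intro borel_measurable_continuous_on_indicator) auto
  qed
  \<comment> \<open>The angle times \<open>j - k\<close> is \<open>pi\<close>, whence
    \<open>c ^ j * cnj c ^ k = -1\<close>.\<close>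
  define c where "c = cis (pi / (real j - real k))"
  have c: "norm c = 1" by (simp add: c_def)
  have "c ^ j * cnj c ^ k = cis (real j * (pi / (real j - real k)) - real k * (pi / (real j - real k)))"
    by (simp only: c_def cis_cnj Complex.DeMoivre cis_mult) simp
  also have "real j * (pi / (real j - real k)) - real k * (pi / (real j - real k)) = pi"
    by (simp only: left_diff_distrib[symmetric]) (use False in simp)
  finally have c_jk: "c ^ j * cnj c ^ k = -1" by simp
  have "F (c * z) = - F z" for z
  proof -
    have "F (c * z) = (c ^ j * cnj c ^ k) * F z"
      using c by (simp add: F_def norm_mult power_mult_distrib indicator_def)
    then show ?thesis by (simp add: c_jk)
  qed
  then have "(LINT z|lborel. F z) = (LINT z|distr lborel borel ((*) c). F z)"
    by (simp add: lborel_distr_rotation[OF c])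
  also have "\<dots> = (LINT z|lborel. F (c * z))" by (subst integral_distr) auto
  also have "\<dots> = - (LINT z|lborel. F z)" by (simp add: \<open>\<And>z. F (c * z) = - F z\<close>)
  finally have "(LINT z|lborel. F z) = 0" by simp
  then show ?thesis using False by (simp add: set_lebesgue_integral_def F_def)
qed

text \<open>The square expands into a double sum of which orthogonality leaves the diagonal. The
  computation is complex because the cross terms are.\<close>

lemma polynomial_weighted_norm:
  fixes r a :: real and b :: "nat \<Rightarrow> complex"
  assumes r: "0 < r" "r < 1"
  shows "(LINT z:ball 0 r|lborel. (1 - (norm z)\<^sup>2) powr (-a) * (norm (\<Sum>k<n. b k * z ^ k))\<^sup>2) =
    pi * (\<Sum>k<n. (norm (b k))\<^sup>2 * weight_moment a k (r\<^sup>2))"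
proof -
  define w where "w z = complex_of_real ((1 - (norm z)\<^sup>2) powr (-a))" for z :: complex
  have int: "set_integrable lborel (ball 0 r) (\<lambda>z. w z * (z ^ j * cnj z ^ k))" for j k
    unfolding w_def by (intro set_integrable_ball_continuous continuous_intros continuous_on_weight r)
  have "complex_of_real (LINT z:ball 0 r|lborel. (1 - (norm z)\<^sup>2) powr (-a) * (norm (\<Sum>k<n. b k * z ^ k))\<^sup>2) =
      (LINT z:ball 0 r|lborel. complex_of_real ((1 - (norm z)\<^sup>2) powr (-a) * (norm (\<Sum>k<n. b k * z ^ k))\<^sup>2))"
    by (rule set_integral_complex_of_real[symmetric])
  also have "\<dots> = (LINT z:ball 0 r|lborel. \<Sum>j<n. \<Sum>k<n. (b j * cnj (b k)) * (w z * (z ^ j * cnj z ^ k)))"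
  proof -
    have "complex_of_real ((1 - (norm z)\<^sup>2) powr (-a) * (norm (\<Sum>k<n. b k * z ^ k))\<^sup>2) =
        (\<Sum>j<n. \<Sum>k<n. (b j * cnj (b k)) * (w z * (z ^ j * cnj z ^ k)))" for z
    proof -
      have "complex_of_real ((1 - (norm z)\<^sup>2) powr (-a) * (norm (\<Sum>k<n. b k * z ^ k))\<^sup>2) =
          w z * ((\<Sum>j<n. b j * z ^ j) * (\<Sum>k<n. cnj (b k) * cnj z ^ k))"
        by (simp only: of_real_mult w_def complex_norm_square cnj_sum complex_cnj_mult complex_cnj_power)
      also have "\<dots> = (\<Sum>j<n. \<Sum>k<n. (b j * cnj (b k)) * (w z * (z ^ j * cnj z ^ k)))"
        by (subst sum_product) (simp add: sum_distrib_left ac_simps)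
      finally show ?thesis .
    qed
    then show ?thesis by simp
  qed
  also have "\<dots> = (\<Sum>j<n. \<Sum>k<n. (b j * cnj (b k)) * (LINT z:ball 0 r|lborel. w z * (z ^ j * cnj z ^ k)))"
  proof -
    define X where "X j k z = indicator (ball 0 r) z *\<^sub>R (w z * (z ^ j * cnj z ^ k))" for j k z
    have X: "integrable lborel (X j k)" for j k
      using int[of j k] by (simp add: X_def[abs_def] set_integrable_def)
    have "(LINT z:ball 0 r|lborel. \<Sum>j<n. \<Sum>k<n. (b j * cnj (b k)) * (w z * (z ^ j * cnj z ^ k))) =
        (LINT z|lborel. (\<Sum>j<n. \<Sum>k<n. (b j * cnj (b k)) * X j k z))"
      by (simp add: set_lebesgue_integral_def scaleR_sum_right X_def)
    also have "\<dots> = (\<Sum>j<n. \<Sum>k<n. (b j * cnj (b k)) * (LINT z|lborel. X j k z))"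
      by (simp add: X)
    finally show ?thesis by (simp add: set_lebesgue_integral_def X_def)
  qed
  also have "\<dots> = (\<Sum>j<n. \<Sum>k<n. (b j * cnj (b k)) * (if j = k then of_real (pi * weight_moment a k (r\<^sup>2)) else 0))"
    unfolding w_def weighted_orthogonality[OF r] ..
  also have "\<dots> = (\<Sum>j<n. complex_of_real ((norm (b j))\<^sup>2 * (pi * weight_moment a j (r\<^sup>2))))"
    by (intro sum.cong refl) (auto simp: sum.delta' if_distrib complex_norm_square[unfolded of_real_power] cong: if_cong)
  also have "\<dots> = complex_of_real (pi * (\<Sum>k<n. (norm (b k))\<^sup>2 * weight_moment a k (r\<^sup>2)))"
    by (simp add: sum_distrib_left ac_simps)
  finally show ?thesis by (simp only: of_real_eq_iff)
qed

text \<open>Dominated convergence carries the identity from the partial sums to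
  \<open>f\<close>.\<close>

lemma power_series_weighted_norm:
  fixes r a :: real and b :: "nat \<Rightarrow> complex" and f :: "complex \<Rightarrow> complex"
  assumes r: "0 < r" "r < 1" and f: "\<And>z. norm z < 1 \<Longrightarrow> (\<lambda>k. b k * z ^ k) sums f z"
  shows "(\<lambda>k. (norm (b k))\<^sup>2 * weight_moment a k (r\<^sup>2)) sums
    ((LINT z:ball 0 r|lborel. (1 - (norm z)\<^sup>2) powr (-a) * (norm (f z))\<^sup>2) / pi)"
proof -
  define s where "s n z = indicator (ball 0 r) z *\<^sub>R
     ((1 - (norm z)\<^sup>2) powr (-a) * (norm (\<Sum>k<n. b k * z ^ k))\<^sup>2)" for n and z :: complex
  define g where "g z = indicator (ball 0 r) z *\<^sub>R ((1 - (norm z)\<^sup>2) powr (-a) * (norm (f z))\<^sup>2)"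
    for z :: complex
  have summable: "summable (\<lambda>k. norm (b k) * r ^ k)"
  proof -
    \<comment> \<open>Convergence at a point of modulus between \<open>r\<close> and 1 gives
      absolute convergence at \<open>r\<close>, hence a bound \<open>C\<close> for all partial sums
      on the ball.\<close>
    define \<rho> where "\<rho> = (r + 1) / 2"
    have \<rho>: "r < \<rho>" "\<rho> < 1" "0 < \<rho>" using r by (auto simp: \<rho>_def)
    have "summable (\<lambda>k. b k * complex_of_real \<rho> ^ k)" using f[of "of_real \<rho>"] \<rho> by (auto simp: sums_iff)
    then have "summable (\<lambda>k. norm (b k * complex_of_real r ^ k))"
      by (rule powser_insidea) (use r \<rho> in auto)
    then show ?thesis using r by (simp add: norm_mult norm_power)
  qed
  define C where "C = (\<Sum>k. norm (b k) * r ^ k)"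
  have bound: "norm (\<Sum>k<n. b k * z ^ k) \<le> C" if "norm z < r" for n z
  proof -
    have "norm (\<Sum>k<n. b k * z ^ k) \<le> (\<Sum>k<n. norm (b k) * r ^ k)"
      using that by (intro sum_norm_le) (auto simp: norm_mult norm_power intro!: mult_left_mono power_mono)
    also have "\<dots> \<le> C" unfolding C_def using r by (intro sum_le_suminf summable) auto
    finally show ?thesis .
  qed
  have s_meas: "s n \<in> borel_measurable lborel" for n
  proof -
    have cont: "continuous_on (ball 0 r) (\<lambda>z. (1 - (norm z)\<^sup>2) powr (-a) * (norm (\<Sum>k<n. b k * z ^ k))\<^sup>2)"
      by (intro continuous_intros continuous_on_subset[OF continuous_on_weight[OF r(2)]]) auto
    then show ?thesis unfolding s_def[abs_def]
      using borel_measurable_continuous_on_indicator[OF _ cont] by simp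
  qed
  have lim: "(\<lambda>n. s n z) \<longlonglongrightarrow> g z" for z
  proof (cases "z \<in> ball 0 r")
    case True
    then have "(\<lambda>n. \<Sum>k<n. b k * z ^ k) \<longlonglongrightarrow> f z" using f[of z] r by (simp add: sums_def)
    then show ?thesis unfolding s_def g_def by (intro tendsto_intros)
  qed (simp add: s_def g_def)
  have "(\<lambda>n. LINT z|lborel. s n z) \<longlonglongrightarrow> (LINT z|lborel. g z)"
  proof (rule integral_dominated_convergence[where w = "\<lambda>z. indicator (ball 0 r) z *\<^sub>R ((1 - (norm z)\<^sup>2) powr (-a) * C\<^sup>2)"])
    show "g \<in> borel_measurable lborel" by (rule borel_measurable_LIMSEQ_real[OF lim s_meas])
    show "integrable lborel (\<lambda>z::complex. indicator (ball 0 r) z *\<^sub>R ((1 - (norm z)\<^sup>2) powr (-a) * C\<^sup>2))"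
      unfolding set_integrable_def[symmetric]
      by (intro set_integrable_ball_continuous continuous_intros continuous_on_weight r)
    show "AE z in lborel. norm (s n z) \<le> indicator (ball 0 r) z *\<^sub>R ((1 - (norm z)\<^sup>2) powr (-a) * C\<^sup>2)" for n
      by (intro AE_I2) (auto simp: s_def indicator_def norm_power intro!: mult_left_mono power_mono bound)
  qed (use s_meas lim in auto)
  then have "(\<lambda>n. (LINT z|lborel. s n z) / pi) \<longlonglongrightarrow> (LINT z|lborel. g z) / pi"
    by (intro tendsto_divide tendsto_const) auto
  moreover have "(LINT z|lborel. s n z) / pi = (\<Sum>k<n. (norm (b k))\<^sup>2 * weight_moment a k (r\<^sup>2))" for n
    using polynomial_weighted_norm[OF r, where a = a and n = n and b = b] by (simp add: s_def set_lebesgue_integral_def)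
  ultimately show ?thesis by (simp add: sums_def g_def set_lebesgue_integral_def)
qed

lemma weighted_area_integral:
  fixes g :: "complex \<Rightarrow> real"
  assumes r: "r \<le> 1" and g: "continuous_on (ball 0 r) g"
  shows "(LINT z:ball 0 r|weighted_area \<alpha>. g z) = (LINT z:ball 0 r|lborel. (1 - (norm z)\<^sup>2) powr \<alpha> * g z)"
proof -
  have eq: "weighted_area \<alpha> = density lborel (\<lambda>z. ennreal (indicator (ball 0 1) z * (1 - (norm z)\<^sup>2) powr \<alpha>))"
    unfolding weighted_area_def by (intro arg_cong2[where f = density] refl) (auto simp: indicator_def)
  have "(\<lambda>z. indicator (ball 0 r) z *\<^sub>R g z) \<in> borel_measurable lborel"
    using borel_measurable_continuous_on_indicator[OF _ g] by simp
  then show ?thesis unfolding eq set_lebesgue_integral_def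
    using r by (subst integral_density) (auto intro!: Bochner_Integration.integral_cong simp: indicator_def)
qed

subsection \<open>The coordinate function outside the range\<close>

text \<open>Subtracting the line leaves a convex \<open>g\<close> with limit \<open>l\<close> at
  minus infinity. In its midpoint inequality for \<open>t\<close> and \<open>u\<close>, letting
  \<open>u\<close> tend there gives \<open>l \<le> (g t + l) / 2\<close>.\<close>

lemma convex_ge_asymptote:
  fixes h :: "real \<Rightarrow> real"
  assumes h: "convex_on {..<0} h" and lim: "((\<lambda>t. h t - c * t) \<longlongrightarrow> l) at_bot" and t: "t < 0"
  shows "l + c * t \<le> h t"
proof -
  define g where "g t = h t - c * t" for t
  have half: "filterlim (\<lambda>u. (t + u) / 2) at_bot at_bot" by real_asymp
  have "((\<lambda>u. (g t + g u) / 2 - g ((t + u) / 2)) \<longlongrightarrow> (g t + l) / 2 - l) at_bot"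
    using lim filterlim_compose[OF lim half] unfolding g_def by (intro tendsto_intros) simp_all
  moreover have "\<forall>\<^sub>F u in at_bot. 0 \<le> (g t + g u) / 2 - g ((t + u) / 2)"
    using eventually_gt_at_bot[of 0]
  proof eventually_elim
    case (elim u)
    then have "h ((t + u) / 2) \<le> (h t + h u) / 2"
      using convex_onD[OF h, of "1/2" t u] t by (simp add: field_simps)
    then show ?case by (simp add: g_def field_simps)
  qed
  ultimately have "0 \<le> (g t + l) / 2 - l" by (rule tendsto_lowerbound) simp
  then show ?thesis by (simp add: g_def)
qed

text \<open>Convexity and the limit 0 give \<open>2 * h (t / 2) \<le> h t\<close>. Iteration
  compares \<open>h t\<close> with \<open>2 ^ n * q (t / 2 ^ n)\<close>, which tends to
  \<open>c * t\<close>; near 0 a minorant \<open>q\<close> with the right slope suffices.\<close>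

lemma convex_ge_tangent_at_0:
  fixes h q :: "real \<Rightarrow> real"
  assumes h: "convex_on {..<0} h" and lim: "(h \<longlongrightarrow> 0) (at_left 0)"
    and q: "\<forall>\<^sub>F s in at_left 0. q s \<le> h s" and slope: "((\<lambda>s. q s / s) \<longlongrightarrow> c) (at_left 0)"
    and t: "t < 0"
  shows "c * t \<le> h t"
proof -
  have cont: "continuous_on {..<0} h" using h by (intro convex_on_continuous) auto
  have halve: "2 * h (t / 2) \<le> h t" if t: "t < 0" for t
  proof -
    have "isCont h (t / 2)" using cont t by (simp add: continuous_on_eq_continuous_at)
    moreover have "((\<lambda>u. (t + u) / 2) \<longlongrightarrow> (t + 0) / 2) (at_left 0)" by (intro tendsto_intros) simp_all
    ultimately have "((\<lambda>u. h ((t + u) / 2)) \<longlongrightarrow> h (t / 2)) (at_left 0)"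
      by (intro isCont_tendsto_compose[of _ h]) simp_all
    then have "((\<lambda>u. (h t + h u) - 2 * h ((t + u) / 2)) \<longlongrightarrow> (h t + 0) - 2 * h (t / 2)) (at_left 0)"
      by (intro tendsto_intros lim)
    moreover have "\<forall>\<^sub>F u in at_left 0. 0 \<le> (h t + h u) - 2 * h ((t + u) / 2)"
      unfolding eventually_at_left_field
    proof (intro exI[of _ "-1"] conjI allI impI)
      fix u :: real assume "-1 < u" "u < 0"
      then show "0 \<le> (h t + h u) - 2 * h ((t + u) / 2)"
        using convex_onD[OF h, of "1/2" t u] t by (simp add: field_simps)
    qed simp
    ultimately have "0 \<le> (h t + 0) - 2 * h (t / 2)" by (rule tendsto_lowerbound) simp
    then show ?thesis by simp
  qed
  have iter: "2 ^ n * h (t / 2 ^ n) \<le> h t" for n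
  proof (induction n)
    case (Suc n)
    have "2 ^ n * (2 * h (t / 2 ^ n / 2)) \<le> 2 ^ n * h (t / 2 ^ n)"
      using t by (intro mult_left_mono halve) (auto simp: divide_neg_pos)
    also note Suc.IH
    finally show ?case by (simp add: mult_ac)
  qed simp
  have to0: "filterlim (\<lambda>n. t / 2 ^ n) (at_left 0) sequentially"
  proof (rule tendsto_imp_filterlim_at_left)
    have "(\<lambda>n. t * (1 / 2) ^ n) \<longlonglongrightarrow> t * 0" by (intro tendsto_intros LIMSEQ_power_zero) auto
    then show "(\<lambda>n. t / 2 ^ n) \<longlonglongrightarrow> 0" by (simp add: power_one_over field_simps)
    show "\<forall>\<^sub>F n in sequentially. t / 2 ^ n < 0" using t by (auto simp: divide_neg_pos)
  qed
  have "(\<lambda>n. q (t / 2 ^ n) / (t / 2 ^ n) * t) \<longlonglongrightarrow> c * t"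
    by (intro tendsto_intros filterlim_compose[OF slope to0])
  moreover have "\<forall>\<^sub>F n in sequentially. q (t / 2 ^ n) / (t / 2 ^ n) * t \<le> h t"
    using filterlim_iff[THEN iffD1, OF to0, rule_format, OF q]
  proof eventually_elim
    case (elim n)
    have "q (t / 2 ^ n) / (t / 2 ^ n) * t = 2 ^ n * q (t / 2 ^ n)" using t by simp
    also have "\<dots> \<le> 2 ^ n * h (t / 2 ^ n)" using elim by (intro mult_left_mono) auto
    also have "\<dots> \<le> h t" by (rule iter)
    finally show ?case .
  qed
  ultimately show ?thesis by (rule tendsto_upperbound) simp
qed

text \<open>The mean of \<open>f(z) = z\<close> as a function of \<open>x = r^2\<close>.\<close>

definition coord_mean :: "real \<Rightarrow> real \<Rightarrow> real" where
  "coord_mean \<alpha> x = weight_moment (-\<alpha>) 1 x / weight_moment (-\<alpha>) 0 x"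

text \<open>The splitting \<open>s = 1 - (1 - s)\<close> reduces the first moment to integrals of
  pure powers of \<open>1 - s\<close>.\<close>

lemma coord_mean_eq:
  assumes x: "0 < x" "x < 1" and \<alpha>: "\<alpha> \<noteq> -1" "\<alpha> \<noteq> -2"
  shows "coord_mean \<alpha> x = 1 - (\<alpha> + 1) / (\<alpha> + 2) * ((1 - (1 - x) powr (\<alpha> + 2)) / (1 - (1 - x) powr (\<alpha> + 1)))"
proof -
  have F0: "weight_moment (-\<alpha>) 0 x = (1 - (1 - x) powr (\<alpha> + 1)) / (\<alpha> + 1)"
    using integral_powr_one_minus[of x \<alpha>] x \<alpha> by (simp add: weight_moment_def)
  have "weight_moment (-\<alpha>) 1 x = integral {0..x} (\<lambda>s. (1 - s) powr \<alpha> - (1 - s) powr (\<alpha> + 1))"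
    unfolding weight_moment_def
  proof (intro Henstock_Kurzweil_Integration.integral_cong)
    fix s assume "s \<in> {0..x}"
    then have "(1 - s) powr (\<alpha> + 1) = (1 - s) powr \<alpha> * (1 - s)" using x by (simp add: powr_add)
    then show "s ^ 1 * (1 - s) powr - (- \<alpha>) = (1 - s) powr \<alpha> - (1 - s) powr (\<alpha> + 1)"
      by (simp add: algebra_simps)
  qed
  also have "\<dots> = integral {0..x} (\<lambda>s. (1 - s) powr \<alpha>) - integral {0..x} (\<lambda>s. (1 - s) powr (\<alpha> + 1))"
    using x by (intro Henstock_Kurzweil_Integration.integral_diff integrable_continuous_real continuous_intros) auto
  also have "\<dots> = weight_moment (-\<alpha>) 0 x - (1 - (1 - x) powr (\<alpha> + 2)) / (\<alpha> + 2)"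
    using integral_powr_one_minus[of x "\<alpha> + 1"] x \<alpha> by (simp add: weight_moment_def add.assoc)
  finally have F1: "weight_moment (-\<alpha>) 1 x = weight_moment (-\<alpha>) 0 x - (1 - (1 - x) powr (\<alpha> + 2)) / (\<alpha> + 2)" .
  have "coord_mean \<alpha> x = 1 - (1 - (1 - x) powr (\<alpha> + 2)) / (\<alpha> + 2) / weight_moment (-\<alpha>) 0 x"
    using weight_moment_pos[OF x, of "-\<alpha>" 0] unfolding coord_mean_def F1 by (simp add: diff_divide_distrib)
  then show ?thesis by (simp add: F0)
qed

lemma coord_mean_pos: "0 < x \<Longrightarrow> x < 1 \<Longrightarrow> 0 < coord_mean \<alpha> x"
  using weight_moment_pos[of x "-\<alpha>"] by (simp add: coord_mean_def)

text \<open>A quadratic Taylor coefficient, needed at \<open>x = 0\<close> for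
  \<open>\<alpha> > 0\<close> and at \<open>x = 1\<close> for \<open>\<alpha> < -3\<close>.\<close>

lemma powr_one_minus_second_order:
  fixes c :: real
  assumes "0 < c"
  shows "((\<lambda>y. ((1 - y) powr c - 1 + c * y) / y\<^sup>2) \<longlongrightarrow> c * (c - 1) / 2) (at_right 0)"
  using assms by real_asymp

text \<open>The mean behaves like \<open>x / 2\<close> at 0, so convexity would force it to be at
  least \<open>x / 2\<close> everywhere. At 1, however, it tends to
  \<open>1 / (\<alpha> + 2)\<close>, which is below \<open>1 / 2\<close>.\<close>

lemma not_convex_coord_mean_pos:
  assumes \<alpha>: "0 < \<alpha>"
  shows "\<not> convex_on {..<0} (\<lambda>t. ln (coord_mean \<alpha> (exp (2 * t))))"
proof
  assume conv: "convex_on {..<0} (\<lambda>t. ln (coord_mean \<alpha> (exp (2 * t))))"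
  define m where "m x = 1 - (\<alpha> + 1) / (\<alpha> + 2) * ((1 - (1 - x) powr (\<alpha> + 2)) / (1 - (1 - x) powr (\<alpha> + 1)))" for x :: real
  have m: "coord_mean \<alpha> x = m x" if "0 < x" "x < 1" for x
    using coord_mean_eq[OF that] \<alpha> by (simp add: m_def)
  have "((\<lambda>x. m x / x) \<longlongrightarrow> 1 / 2) (at_right 0)"
  proof -
    define c where "c = \<alpha> + 1"
    have c: "1 < c" using \<alpha> by (simp add: c_def)
    \<comment> \<open>The scaled second-order remainder. In terms of it, \<open>m x / x\<close> is a
      quotient whose denominator has the nonzero limit \<open>c\<close>.\<close>
    define A where "A d x = ((1 - x) powr d - 1 + d * x) / x\<^sup>2" for d x :: real
    have A: "(A d \<longlongrightarrow> d * (d - 1) / 2) (at_right 0)" if "0 < d" for d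
      unfolding A_def[abs_def] using that by (rule powr_one_minus_second_order)
    have "((\<lambda>x. (c / (c + 1) * A (c + 1) x - A c x) / (c - x * A c x)) \<longlongrightarrow>
        (c / (c + 1) * ((c + 1) * (c + 1 - 1) / 2) - c * (c - 1) / 2) / (c - 0 * (c * (c - 1) / 2))) (at_right 0)"
      using c by (intro tendsto_intros A) auto
    also have "(c / (c + 1) * ((c + 1) * (c + 1 - 1) / 2) - c * (c - 1) / 2) / (c - 0 * (c * (c - 1) / 2)) = 1 / 2"
      using c by (simp add: divide_simps) (simp add: algebra_simps)
    finally have "((\<lambda>x. (c / (c + 1) * A (c + 1) x - A c x) / (c - x * A c x)) \<longlongrightarrow> 1 / 2) (at_right 0)" .
    moreover have "\<forall>\<^sub>F x in at_right 0. (c / (c + 1) * A (c + 1) x - A c x) / (c - x * A c x) = m x / x"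
      unfolding eventually_at_right_field
    proof (intro exI[of _ 1] conjI allI impI)
      fix x :: real assume x: "0 < x" "x < 1"
      define p where "p = (1 - x) powr c"
      have p: "p < 1" "(1 - x) powr (c + 1) = p * (1 - x)"
        using x c powr_less_mono2[of c "1 - x" 1] by (auto simp: p_def powr_add)
      have D: "c - x * A c x = (1 - p) / x"
        using x by (simp add: A_def p_def[symmetric] field_simps power2_eq_square)
      have N: "c / (c + 1) * A (c + 1) x - A c x = (1 - p - c / (c + 1) * (1 - p * (1 - x))) / x\<^sup>2"
        using x c by (simp add: A_def p(2) p_def[symmetric] divide_simps) (simp add: algebra_simps)
      have "m x = 1 - c / (c + 1) * ((1 - p * (1 - x)) / (1 - p))"
        using p(2) by (simp add: m_def p_def c_def add.assoc)
      also have "\<dots> = (1 - p - c / (c + 1) * (1 - p * (1 - x))) / (1 - p)"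
        using p(1) by (simp add: diff_divide_distrib[of "1 - p"])
      finally show "(c / (c + 1) * A (c + 1) x - A c x) / (c - x * A c x) = m x / x"
        unfolding D N using x p(1) by (simp add: power2_eq_square)
    qed simp
    ultimately show ?thesis by (rule Lim_transform_eventually)
  qed
  moreover have "filterlim (\<lambda>t::real. exp (2 * t)) (at_right 0) at_bot" by real_asymp
  ultimately have "((\<lambda>t. m (exp (2 * t)) / exp (2 * t)) \<longlongrightarrow> 1 / 2) at_bot"
    by (rule filterlim_compose)
  then have "((\<lambda>t. ln (m (exp (2 * t)) / exp (2 * t))) \<longlongrightarrow> ln (1 / 2)) at_bot"
    by (intro tendsto_ln) auto
  moreover have "\<forall>\<^sub>F t in at_bot. ln (m (exp (2 * t)) / exp (2 * t)) = ln (coord_mean \<alpha> (exp (2 * t))) - 2 * t"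
    using eventually_gt_at_bot[of 0]
  proof eventually_elim
    case (elim t)
    then have "0 < coord_mean \<alpha> (exp (2 * t))" by (intro coord_mean_pos) auto
    then show ?case using elim by (simp add: m[symmetric] ln_div)
  qed
  ultimately have lim: "((\<lambda>t. ln (coord_mean \<alpha> (exp (2 * t))) - 2 * t) \<longlongrightarrow> ln (1 / 2)) at_bot"
    by (simp add: tendsto_cong)
  have ge: "x / 2 \<le> m x" if x: "0 < x" "x < 1" for x
  proof -
    have "ln (1 / 2) + 2 * (ln x / 2) \<le> ln (coord_mean \<alpha> (exp (2 * (ln x / 2))))"
      using convex_ge_asymptote[OF conv lim, of "ln x / 2"] x by simp
    then have "ln (x / 2) \<le> ln (m x)" using x by (simp add: m ln_div)
    then show ?thesis using coord_mean_pos[OF x, of \<alpha>] m[OF x] x by simp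
  qed
  \<comment> \<open>At 1 the base \<open>1 - x\<close> tends to 0, where the limit rule for
    \<open>powr\<close> asks for an eventually nonnegative base.\<close>
  have le1: "\<forall>\<^sub>F x::real in at_left 1. x \<le> 1" by (simp add: eventually_at_filter)
  have "((\<lambda>x. m x - x / 2) \<longlongrightarrow> 1 - (\<alpha> + 1) / (\<alpha> + 2) * ((1 - (1 - 1) powr (\<alpha> + 2)) / (1 - (1 - 1) powr (\<alpha> + 1))) - 1 / 2) (at_left 1)"
    unfolding m_def using \<alpha> le1 by (intro tendsto_intros) auto
  moreover have "\<forall>\<^sub>F x in at_left 1. 0 \<le> m x - x / 2"
    unfolding eventually_at_left_field using ge by (intro exI[of _ 0]) auto
  ultimately have "0 \<le> 1 - (\<alpha> + 1) / (\<alpha> + 2) * ((1 - (1 - 1) powr (\<alpha> + 2)) / (1 - (1 - 1) powr (\<alpha> + 1))) - 1 / 2"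
    by (rule tendsto_lowerbound) simp
  then show False using \<alpha> by (simp add: field_simps)
qed

text \<open>With \<open>y = 1 - x\<close> the mean is \<open>1 - L * y + R y\<close>, where
  \<open>R y\<close> is of smaller order than \<open>y^2\<close>. Convexity would force it above
  \<open>x powr L\<close>, whose expansion has the same linear part but the positive quadratic
  coefficient \<open>L * (L - 1) / 2\<close>.\<close>

lemma not_convex_coord_mean_neg:
  assumes \<alpha>: "\<alpha> < -3"
  shows "\<not> convex_on {..<0} (\<lambda>t. ln (coord_mean \<alpha> (exp (2 * t))))"
proof
  assume conv: "convex_on {..<0} (\<lambda>t. ln (coord_mean \<alpha> (exp (2 * t))))"
  define b where "b = - \<alpha> - 1"
  have b: "2 < b" using \<alpha> by (simp add: b_def)
  define L where "L = b / (b - 1)"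
  have L: "1 < L" using b by (simp add: L_def)
  define R where "R y = L * (y powr b * (1 - y) / (1 - y powr b))" for y :: real
  have m: "coord_mean \<alpha> (1 - y) = 1 - L * y + R y" if y: "0 < y" "y < 1" for y
  proof -
    define p where "p = y powr b"
    have p: "0 < p" "p < 1" using y b powr_less_mono2[of b y 1] by (auto simp: p_def)
    have p1: "y powr (\<alpha> + 1) = 1 / p" using powr_minus_divide[of y b] by (simp add: p_def b_def add.commute)
    have p2: "y powr (\<alpha> + 2) = y / p"
      using p1 y powr_add[of y "\<alpha> + 1" 1] by (simp add: add.assoc)
    have "coord_mean \<alpha> (1 - y) = 1 - L * ((1 - y / p) / (1 - 1 / p))"
    proof -
      have "(\<alpha> + 1) / (\<alpha> + 2) = L" using \<alpha> by (simp add: L_def b_def divide_simps) (simp add: algebra_simps)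
      then show ?thesis using coord_mean_eq[of "1 - y" \<alpha>] y \<alpha> p1 p2 by simp
    qed
    also have "(1 - y / p) / (1 - 1 / p) = y - p * (1 - y) / (1 - p)"
      using p by (simp add: divide_simps) (simp add: algebra_simps)
    finally show ?thesis by (simp add: R_def p_def right_diff_distrib)
  qed
  have R0: "0 \<le> R y" if y: "0 < y" "y < 1" for y
    using y b L powr_less_mono2[of b y 1] by (simp add: R_def)
  \<comment> \<open>\<open>R y\<close> is of order \<open>y powr b\<close>, and
    \<open>\<alpha> < -3\<close> is exactly \<open>b > 2\<close>.\<close>
  have R_lim: "((\<lambda>y. R y / y\<^sup>2) \<longlongrightarrow> 0) (at_right 0)"
  proof -
    have "((\<lambda>y. L * (y powr (b - 2) * (1 - y) / (1 - y powr b))) \<longlongrightarrow> L * (0 powr (b - 2) * (1 - 0) / (1 - 0 powr b))) (at_right (0::real))"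
      using b by (intro tendsto_intros) (auto simp: eventually_at_right_less intro: eventually_mono[OF eventually_at_right_less])
    moreover have "\<forall>\<^sub>F y in at_right 0. L * (y powr (b - 2) * (1 - y) / (1 - y powr b)) = R y / y\<^sup>2"
      using eventually_at_right_less
    proof eventually_elim
      case (elim y)
      then have "y powr (b - 2) = y powr b / y\<^sup>2" by (simp add: powr_diff)
      then show ?case by (simp add: R_def)
    qed
    ultimately have "((\<lambda>y. R y / y\<^sup>2) \<longlongrightarrow> L * (0 powr (b - 2) * (1 - 0) / (1 - 0 powr b))) (at_right 0)"
      by (rule Lim_transform_eventually)
    then show ?thesis using b by simp
  qed
  have ge: "x powr L \<le> coord_mean \<alpha> x" if x: "0 < x" "x < 1" for x
  proof -
    \<comment> \<open>Dropping the nonnegative \<open>R\<close> leaves a minorant with slope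
      \<open>2 * L\<close> at 0.\<close>
    let ?q = "\<lambda>s::real. ln (1 - L * (1 - exp (2 * s)))"
    have slope: "((\<lambda>s. ?q s / s) \<longlongrightarrow> 2 * L) (at_left 0)"
      using L by real_asymp
    have q_ev: "\<forall>\<^sub>F s in at_left 0. 0 < 1 - L * (1 - exp (2 * s))"
      using L by real_asymp
    have neg: "\<forall>\<^sub>F s::real in at_left 0. s < 0" by (simp add: eventually_at_filter)
    have q: "\<forall>\<^sub>F s in at_left 0. ?q s \<le> ln (coord_mean \<alpha> (exp (2 * s)))"
      using q_ev neg
    proof eventually_elim
      case (elim s)
      have "1 - L * (1 - exp (2 * s)) \<le> coord_mean \<alpha> (exp (2 * s))"
        using m[of "1 - exp (2 * s)"] R0[of "1 - exp (2 * s)"] elim by simp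
      then show ?case using elim by simp
    qed
    have "((\<lambda>y. 1 - L * y + R y / y\<^sup>2 * y\<^sup>2) \<longlongrightarrow> 1 - L * 0 + 0 * 0\<^sup>2) (at_right 0)"
      by (intro tendsto_intros R_lim)
    moreover have "\<forall>\<^sub>F y in at_right 0. 1 - L * y + R y / y\<^sup>2 * y\<^sup>2 = coord_mean \<alpha> (1 - y)"
      unfolding eventually_at_right_field using m by (intro exI[of _ 1]) auto
    ultimately have "((\<lambda>y. coord_mean \<alpha> (1 - y)) \<longlongrightarrow> 1 - L * 0 + 0 * 0\<^sup>2) (at_right 0)"
      by (rule Lim_transform_eventually)
    then have "((\<lambda>y. coord_mean \<alpha> (1 - y)) \<longlongrightarrow> 1) (at_right 0)" by simp
    moreover have "filterlim (\<lambda>s::real. 1 - exp (2 * s)) (at_right 0) (at_left 0)" by real_asymp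
    ultimately have "((\<lambda>s. coord_mean \<alpha> (1 - (1 - exp (2 * s)))) \<longlongrightarrow> 1) (at_left 0)"
      by (rule filterlim_compose)
    then have "((\<lambda>s. ln (coord_mean \<alpha> (exp (2 * s)))) \<longlongrightarrow> ln 1) (at_left 0)"
      by (intro tendsto_ln) auto
    then have "2 * L * (ln x / 2) \<le> ln (coord_mean \<alpha> (exp (2 * (ln x / 2))))"
      using x by (intro convex_ge_tangent_at_0[OF conv _ q slope]) auto
    then have "L * ln x \<le> ln (coord_mean \<alpha> x)" using x by simp
    then show ?thesis using coord_mean_pos[OF x, of \<alpha>] x by (simp add: ln_ge_iff powr_def)
  qed
  \<comment> \<open>Dividing the inequality \<open>ge\<close> by \<open>y\<^sup>2\<close> and
    letting \<open>y\<close> tend to 0 exposes the quadratic coefficients.\<close>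
  have "((\<lambda>y. R y / y\<^sup>2 - ((1 - y) powr L - 1 + L * y) / y\<^sup>2) \<longlongrightarrow> 0 - L * (L - 1) / 2) (at_right 0)"
  proof (intro tendsto_diff R_lim)
    show "((\<lambda>y. ((1 - y) powr L - 1 + L * y) / y\<^sup>2) \<longlongrightarrow> L * (L - 1) / 2) (at_right 0)"
      using L by (intro powr_one_minus_second_order) simp
  qed
  moreover have "\<forall>\<^sub>F y in at_right 0. 0 \<le> R y / y\<^sup>2 - ((1 - y) powr L - 1 + L * y) / y\<^sup>2"
    unfolding eventually_at_right_field
  proof (intro exI[of _ 1] conjI allI impI)
    fix y :: real assume y: "0 < y" "y < 1"
    then have "0 \<le> (R y - ((1 - y) powr L - 1 + L * y)) / y\<^sup>2"
      using ge[of "1 - y"] m[OF y] by simp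
    then show "0 \<le> R y / y\<^sup>2 - ((1 - y) powr L - 1 + L * y) / y\<^sup>2" by (simp add: diff_divide_distrib)
  qed simp
  ultimately have "0 \<le> 0 - L * (L - 1) / 2" by (rule tendsto_lowerbound) simp
  moreover have "0 < L * (L - 1)" using L by simp
  ultimately show False by simp
qed

subsection \<open>Integral means of analytic functions\<close>

text \<open>Parseval gives the numerator and the radial moment with \<open>k = 0\<close> the
  denominator; the common factor \<open>pi\<close> cancels.\<close>

lemma integral_mean_sums:
  fixes f :: "complex \<Rightarrow> complex" and b :: "nat \<Rightarrow> complex"
  assumes r: "0 < r" "r < 1" and cont: "continuous_on (ball 0 1) f"
    and f: "\<And>z. norm z < 1 \<Longrightarrow> (\<lambda>k. b k * z ^ k) sums f z"
  shows "(\<lambda>k. (norm (b k))\<^sup>2 * (weight_moment (-\<alpha>) k (r\<^sup>2) / weight_moment (-\<alpha>) 0 (r\<^sup>2))) sums integral_mean 2 \<alpha> f r"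
proof -
  have cont': "continuous_on (ball 0 r) f" using r by (intro continuous_on_subset[OF cont]) auto
  have "(LINT z:ball 0 r|weighted_area \<alpha>. norm (f z) powr 2) = (LINT z:ball 0 r|weighted_area \<alpha>. (norm (f z))\<^sup>2)"
    by simp
  also have "\<dots> = (LINT z:ball 0 r|lborel. (1 - (norm z)\<^sup>2) powr \<alpha> * (norm (f z))\<^sup>2)"
    using r by (intro weighted_area_integral continuous_intros cont') auto
  finally have num: "(LINT z:ball 0 r|weighted_area \<alpha>. norm (f z) powr 2) =
      (LINT z:ball 0 r|lborel. (1 - (norm z)\<^sup>2) powr \<alpha> * (norm (f z))\<^sup>2)" .
  have "(LINT z:ball 0 r|weighted_area \<alpha>. 1) = (LINT z:ball (0 :: complex) r|lborel. (1 - (norm z)\<^sup>2) powr \<alpha> * 1)"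
    using r by (intro weighted_area_integral continuous_intros) auto
  also have "\<dots> = pi * weight_moment (-\<alpha>) 0 (r\<^sup>2)" using radial_moment[OF r, of "-\<alpha>" 0] by simp
  finally have den: "(LINT z:ball 0 r|weighted_area \<alpha>. 1) = pi * weight_moment (-\<alpha>) 0 (r\<^sup>2)" .
  show ?thesis
    using sums_divide[OF power_series_weighted_norm[OF r f, of "-\<alpha>"], of "weight_moment (-\<alpha>) 0 (r\<^sup>2)"]
    unfolding integral_mean_def num den by (simp add: mult.commute)
qed

lemma convex_in_log_integral_mean:
  assumes \<alpha>: "-3 \<le> \<alpha>" "\<alpha> \<le> 0" and f: "f analytic_on ball 0 1" and nz: "\<exists>z\<in>ball 0 1. f z \<noteq> 0"
  shows "convex_in_log (\<lambda>r. ln (integral_mean 2 \<alpha> f r))"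
  unfolding convex_in_log_def
proof (rule log_convex_sums)
  define b where "b n = (deriv ^^ n) f 0 / fact n" for n
  have hol: "f holomorphic_on ball 0 1" using f by (rule analytic_imp_holomorphic)
  have sums: "(\<lambda>k. b k * z ^ k) sums f z" if "norm z < 1" for z
    using holomorphic_power_series[OF hol, of z] that by (simp add: b_def)
  define h where "h k t = weight_moment (-\<alpha>) k (exp (2 * t)) / weight_moment (-\<alpha>) 0 (exp (2 * t))" for k and t :: real
  show mean: "(\<lambda>k. (norm (b k))\<^sup>2 * h k t) sums integral_mean 2 \<alpha> f (exp t)" if t: "t \<in> {..<0}" for t
  proof -
    have "(exp t)\<^sup>2 = exp (2 * t)" by (simp add: exp_double)
    then show ?thesis
      using integral_mean_sums[OF _ _ holomorphic_on_imp_continuous_on[OF hol] sums, of "exp t" \<alpha>] t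
      by (simp add: h_def)
  qed
  show h_pos: "0 < h k t" if "t \<in> {..<0}" for k t
    using that weight_moment_pos[of "exp (2 * t)"] by (simp add: h_def)
  show "convex_on {..<0} (\<lambda>t. ln (h k t))" for k
    unfolding h_def using \<alpha> by (intro monomial_mean_log_convex) auto
  show "0 < integral_mean 2 \<alpha> f (exp t)" if t: "t \<in> {..<0}" for t
  proof -
    \<comment> \<open>If all Taylor coefficients vanished, \<open>f\<close> would vanish on the
      disc. One nonzero coefficient makes the mean positive, as \<open>log_convex_sums\<close>
      requires.\<close>
    have "\<exists>k. b k \<noteq> 0"
    proof (rule ccontr)
      assume "\<not> (\<exists>k. b k \<noteq> 0)"
      then have "f z = 0" if "norm z < 1" for z
        using sums[OF that] by (auto dest: sums_unique)
      then show False using nz by auto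
    qed
    then obtain k where k: "b k \<noteq> 0" by blast
    have "0 < (norm (b k))\<^sup>2 * h k t" using k h_pos[OF t] by simp
    moreover have "0 \<le> (norm (b n))\<^sup>2 * h n t" for n using h_pos[OF t, of n] by simp
    ultimately have "0 < (\<Sum>k. (norm (b k))\<^sup>2 * h k t)"
      using mean[OF t] by (intro suminf_pos2) (auto simp: sums_iff)
    then show ?thesis using mean[OF t] by (simp add: sums_iff)
  qed
qed auto

lemma integral_mean_id:
  assumes r: "0 < r" "r < 1"
  shows "integral_mean 2 \<alpha> (\<lambda>z. z) r = coord_mean \<alpha> (r\<^sup>2)"
proof -
  define b :: "nat \<Rightarrow> complex" where "b k = (if k = 1 then 1 else 0)" for k
  have "(\<lambda>k. b k * z ^ k) sums z" for z
    using sums_single[of 1 "\<lambda>k. z ^ k"] by (simp add: b_def if_distrib if_distribR cong: if_cong)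
  from integral_mean_sums[OF r _ this, of \<alpha>]
  have "(\<lambda>k. (norm (b k))\<^sup>2 * (weight_moment (-\<alpha>) k (r\<^sup>2) / weight_moment (-\<alpha>) 0 (r\<^sup>2))) sums integral_mean 2 \<alpha> (\<lambda>z. z) r"
    by (simp add: continuous_on_id)
  moreover have "(\<lambda>k. (norm (b k))\<^sup>2 * (weight_moment (-\<alpha>) k (r\<^sup>2) / weight_moment (-\<alpha>) 0 (r\<^sup>2))) sums coord_mean \<alpha> (r\<^sup>2)"
    using sums_single[of 1 "\<lambda>k. weight_moment (-\<alpha>) k (r\<^sup>2) / weight_moment (-\<alpha>) 0 (r\<^sup>2)"]
    by (simp add: b_def coord_mean_def if_distrib if_distribR cong: if_cong)
  ultimately show ?thesis by (rule sums_unique2)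
qed

lemma not_convex_in_log_integral_mean_id:
  assumes \<alpha>: "\<alpha> \<notin> {-3..0}"
  shows "\<not> convex_in_log (\<lambda>r. ln (integral_mean 2 \<alpha> (\<lambda>z. z) r))"
proof
  assume "convex_in_log (\<lambda>r. ln (integral_mean 2 \<alpha> (\<lambda>z. z) r))"
  then have "convex_on {..<0} (\<lambda>t. ln (integral_mean 2 \<alpha> (\<lambda>z. z) (exp t)))"
    by (simp add: convex_in_log_def)
  moreover have "ln (integral_mean 2 \<alpha> (\<lambda>z. z) (exp t)) = ln (coord_mean \<alpha> (exp (2 * t)))" if "t \<in> {..<0}" for t
    using that by (simp add: integral_mean_id exp_double)
  ultimately have "convex_on {..<0} (\<lambda>t. ln (coord_mean \<alpha> (exp (2 * t))))"
    by (rule convex_on_transform) simp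
  then show False using \<alpha> not_convex_coord_mean_pos[of \<alpha>] not_convex_coord_mean_neg[of \<alpha>] by auto
qed

theorem theorem8:
  shows "(\<forall>\<alpha>::real. -3 \<le> \<alpha> \<and> \<alpha> \<le> 0 \<longrightarrow>
           (\<forall>f::complex \<Rightarrow> complex. f analytic_on ball 0 1 \<and> (\<exists>z\<in>ball 0 1. f z \<noteq> 0) \<longrightarrow>
              convex_in_log (\<lambda>r. ln (integral_mean 2 \<alpha> f r)))) \<and>
         (\<forall>\<alpha>::real. \<alpha> \<notin> {-3..0} \<longrightarrow>
           (\<exists>f::complex \<Rightarrow> complex. f analytic_on ball 0 1 \<and> (\<exists>z\<in>ball 0 1. f z \<noteq> 0) \<and>
              \<not> convex_in_log (\<lambda>r. ln (integral_mean 2 \<alpha> f r))))"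
proof (intro conjI allI impI)
  fix \<alpha> :: real and f :: "complex \<Rightarrow> complex"
  assume "-3 \<le> \<alpha> \<and> \<alpha> \<le> 0" "f analytic_on ball 0 1 \<and> (\<exists>z\<in>ball 0 1. f z \<noteq> 0)"
  then show "convex_in_log (\<lambda>r. ln (integral_mean 2 \<alpha> f r))"
    by (intro convex_in_log_integral_mean) auto
next
  fix \<alpha> :: real
  assume \<alpha>: "\<alpha> \<notin> {-3..0}"
  have "(\<lambda>z. z) analytic_on ball (0 :: complex) 1" by (rule analytic_on_ident)
  moreover have "\<exists>z\<in>ball (0 :: complex) 1. z \<noteq> 0" by (intro bexI[of _ "1/2"]) auto
  ultimately show "\<exists>f::complex \<Rightarrow> complex. f analytic_on ball 0 1 \<and> (\<exists>z\<in>ball 0 1. f z \<noteq> 0) \<and>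
      \<not> convex_in_log (\<lambda>r. ln (integral_mean 2 \<alpha> f r))"
    using not_convex_in_log_integral_mean_id[OF \<alpha>] by (intro exI[of _ "\<lambda>z. z"]) simp
qed

end
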